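(* The law of the steady state cluster $(\mathcal{C},\rho)$ is re-root invariant: if, given $(\mathcal{C},\rho)$, a vertex $\rho'$ of $\mathcal{C}$ is chosen uniformly at random, then $(\mathcal{C},\rho')$ has the same law as $(\mathcal{C},\rho)$ as a rooted tree up to isomorphism.
   Context: The steady state cluster $(\mathcal{C},\rho)$ is the random finite rooted tree (up to isomorphism) with law $\mathcal{W}_0$ defined as follows. For a probability law $\mathcal{W}$ on isomorphism classes of finite rooted simple graphs, let $\mathcal{C}_1^{\mathcal W}(t)$ be the process started from a single root vertex $\rho$ which, when it has $k$ vertices, waits an independent exponential time of rate $k$ and then attaches an independent $\mathcal{W}$-distributed rooted graph $(C,r)$ by adding an edge from $r$ to a uniformly random vertex of the current graph, the root remaining $\rho$; let $t_\infty$ be the limit of the jump times. If $\mathbb{E}(t_\infty)<\infty$, let $\mathcal{C}^{\mathcal W}(t)$, $t\in\mathbb{R}$, be the stationary process obtained by concatenating independent copies of $\mathcal{C}_1^{\mathcal W}$ on consecutive time intervals (returning to the singleton at each explosion), the copy whose interval contains $0$ being size-biased by its lifetime, with $0$ placed uniformly in that interval. $\mathcal{W}_0$ is the unique law $\mathcal{W}$ such that $\mathcal{C}_1^{\mathcal W}$ explodes almost surely and $\mathcal{C}^{\mathcal W}(0)$ has law $\mathcal{W}$; it is supported on finite rooted trees. *)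

theory Defs
  imports "HOL-Probability.Probability"
begin

(* A finite rooted graph with vertex set {..<nverts G}; up to isomorphism this covers every
   finite rooted graph.  An edge is a two-element set of vertices. *)
record rgraph =
  nverts :: nat
  edges :: "nat set set"
  root :: nat

definition rooted_graph :: "rgraph \<Rightarrow> bool" where
  "rooted_graph G \<longleftrightarrow>
     root G < nverts G \<and> (\<forall>e\<in>edges G. e \<subseteq> {..<nverts G} \<and> card e = 2)"

definition rooted_iso :: "rgraph \<Rightarrow> rgraph \<Rightarrow> bool" where
  "rooted_iso G H \<longleftrightarrow> rooted_graph G \<and> rooted_graph H \<and>
     (\<exists>f. bij_betw f {..<nverts G} {..<nverts H} \<and>
          edges H = (\<lambda>e. f ` e) ` edges G \<and> f (root G) = root H)"

definition singleton_graph :: rgraph where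
  "singleton_graph = \<lparr>nverts = 1, edges = {}, root = 0\<rparr>"

lemma rooted_iso_refl: "rooted_graph G \<Longrightarrow> rooted_iso G G"
  unfolding rooted_iso_def by (auto intro!: exI[of _ id])

lemma rooted_iso_sym:
  assumes "rooted_iso G H"
  shows "rooted_iso H G"
proof -
  obtain f where G: "rooted_graph G" and H: "rooted_graph H"
    and f: "bij_betw f {..<nverts G} {..<nverts H}"
    and e: "edges H = (\<lambda>e. f ` e) ` edges G" and r: "f (root G) = root H"
    using assms unfolding rooted_iso_def by blast
  define g where "g = inv_into {..<nverts G} f"
  have g: "bij_betw g {..<nverts H} {..<nverts G}"
    unfolding g_def using f by (rule bij_betw_inv_into)
  have gf: "g (f x) = x" if "x < nverts G" for x
    unfolding g_def using f that by (simp add: bij_betw_inv_into_left)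
  have "g ` (f ` e) = e" if "e \<in> edges G" for e
  proof -
    have "e \<subseteq> {..<nverts G}" using G that unfolding rooted_graph_def by blast
    then have "g (f x) = x" if "x \<in> e" for x using that gf by auto
    then show ?thesis by (simp add: image_image)
  qed
  then have "(\<lambda>e. g ` e) ` edges H = edges G"
    unfolding e by (simp add: image_image)
  moreover have "g (root H) = root G"
    using gf[of "root G"] G r unfolding rooted_graph_def by simp
  ultimately show ?thesis
    unfolding rooted_iso_def using G H g by metis
qed

lemma rooted_iso_trans:
  assumes "rooted_iso G H" and "rooted_iso H K"
  shows "rooted_iso G K"
proof -
  obtain f where f: "bij_betw f {..<nverts G} {..<nverts H}"
    "edges H = (\<lambda>e. f ` e) ` edges G" "f (root G) = root H"
    using assms(1) unfolding rooted_iso_def by blast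
  obtain g where g: "bij_betw g {..<nverts H} {..<nverts K}"
    "edges K = (\<lambda>e. g ` e) ` edges H" "g (root H) = root K"
    using assms(2) unfolding rooted_iso_def by blast
  have "bij_betw (g \<circ> f) {..<nverts G} {..<nverts K}"
    using f(1) g(1) by (rule bij_betw_trans)
  moreover have "edges K = (\<lambda>e. (g \<circ> f) ` e) ` edges G"
    unfolding g(2) f(2) by (simp add: image_image image_comp)
  ultimately show ?thesis
    using assms f(3) g(3) unfolding rooted_iso_def by (metis comp_apply)
qed

quotient_type rooted_class = rgraph / partial: rooted_iso
proof (rule part_equivpI)
  show "\<exists>G. rooted_iso G G"
    by (rule exI[of _ singleton_graph], rule rooted_iso_refl)
       (simp add: rooted_graph_def singleton_graph_def)
  show "symp rooted_iso" by (blast intro: sympI rooted_iso_sym)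
  show "transp rooted_iso" by (blast intro: transpI rooted_iso_trans)
qed

(* Disjoint union of G and C (vertices of C shifted by nverts G) with an edge added from
   the root of C to the vertex v of G. *)
definition graft :: "rgraph \<Rightarrow> nat \<Rightarrow> rgraph \<Rightarrow> rgraph" where
  "graft G v C =
     \<lparr>nverts = nverts G + nverts C,
      edges = edges G \<union> (\<lambda>e. (\<lambda>x. nverts G + x) ` e) ` edges C \<union> {{v, nverts G + root C}},
      root = root G\<rparr>"

(* The randomness driving one growth step: the graph attached, a uniform variable selecting
   the attachment vertex, and a rate-1 exponential variable which is divided by the current
   number k of vertices to give a waiting time of rate k. *)
type_synonym step = "rooted_class \<times> real \<times> real"

definition step_measure :: "rooted_class pmf \<Rightarrow> step measure" where
  "step_measure W = measure_pmf W \<Otimes>\<^sub>M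
     (uniform_measure lborel {0..<1} \<Otimes>\<^sub>M density lborel (\<lambda>x. ennreal (exponential_density 1 x)))"

definition growth_measure :: "rooted_class pmf \<Rightarrow> (nat \<Rightarrow> step) measure" where
  "growth_measure W = Pi\<^sub>M UNIV (\<lambda>_. step_measure W)"

(* The labelled graph after n attachments.  If u is uniform on [0,1) then floor (u * k) is
   uniform on the k vertices.  The isomorphism class of the result has a law that does not
   depend on the representatives of the attached classes. *)
primrec growth_chain :: "(nat \<Rightarrow> step) \<Rightarrow> nat \<Rightarrow> rgraph" where
  "growth_chain \<omega> 0 = singleton_graph"
| "growth_chain \<omega> (Suc n) =
     (case \<omega> n of (c, u, _) \<Rightarrow>
        graft (growth_chain \<omega> n) (nat \<lfloor>u * real (nverts (growth_chain \<omega> n))\<rfloor>)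
          (rep_rooted_class c))"

definition waiting_time :: "(nat \<Rightarrow> step) \<Rightarrow> nat \<Rightarrow> real" where
  "waiting_time \<omega> n = (case \<omega> n of (_, _, e) \<Rightarrow> e / real (nverts (growth_chain \<omega> n)))"

definition jump_time :: "(nat \<Rightarrow> step) \<Rightarrow> nat \<Rightarrow> real" where
  "jump_time \<omega> n = (\<Sum>i<n. waiting_time \<omega> i)"

definition explosion_time :: "(nat \<Rightarrow> step) \<Rightarrow> ennreal" where
  "explosion_time \<omega> = lim (\<lambda>n. ennreal (jump_time \<omega> n))"

(* The process started from the singleton, meaningful for times in [0, explosion_time). *)
definition growth_process :: "(nat \<Rightarrow> step) \<Rightarrow> real \<Rightarrow> rooted_class" where
  "growth_process \<omega> t =
     abs_rooted_class (growth_chain \<omega> (LEAST n. t < jump_time \<omega> (Suc n)))"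

definition explodes_as :: "rooted_class pmf \<Rightarrow> bool" where
  "explodes_as W \<longleftrightarrow> (AE \<omega> in growth_measure W. explosion_time \<omega> < \<infinity>)"

definition mean_explosion_time :: "rooted_class pmf \<Rightarrow> ennreal" where
  "mean_explosion_time W = (\<integral>\<^sup>+\<omega>. explosion_time \<omega> \<partial>growth_measure W)"

definition size_biased_measure :: "rooted_class pmf \<Rightarrow> (nat \<Rightarrow> step) measure" where
  "size_biased_measure W =
     density (growth_measure W) (\<lambda>\<omega>. explosion_time \<omega> / mean_explosion_time W)"

(* Independent copies indexed by the integers, copy 0 being size-biased, together with an
   independent uniform variable locating time 0 inside the lifetime of copy 0. *)
definition stationary_measure :: "rooted_class pmf \<Rightarrow> ((int \<Rightarrow> nat \<Rightarrow> step) \<times> real) measure" where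
  "stationary_measure W =
     Pi\<^sub>M UNIV (\<lambda>k. if k = 0 then size_biased_measure W else growth_measure W)
       \<Otimes>\<^sub>M uniform_measure lborel {0..<1}"

definition lifetime :: "(nat \<Rightarrow> step) \<Rightarrow> real" where
  "lifetime \<omega> = enn2real (explosion_time \<omega>)"

(* Starting time of copy k: at most one of the two sums has a nonempty range. *)
definition start_time :: "(int \<Rightarrow> nat \<Rightarrow> step) \<times> real \<Rightarrow> int \<Rightarrow> real" where
  "start_time x k =
     (case x of (\<omega>, u) \<Rightarrow>
        - u * lifetime (\<omega> 0) + (\<Sum>i\<in>{0..<k}. lifetime (\<omega> i)) - (\<Sum>i\<in>{k..<0}. lifetime (\<omega> i)))"

definition stationary_process :: "(int \<Rightarrow> nat \<Rightarrow> step) \<times> real \<Rightarrow> real \<Rightarrow> rooted_class" where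
  "stationary_process x t =
     (let k = (LEAST k. start_time x k \<le> t \<and> t < start_time x (k + 1))
      in growth_process (fst x k) (t - start_time x k))"

(* W is the law of the steady state cluster: the growth process explodes almost surely, the
   stationary process exists, and its value at time 0 has law W. *)
definition steady_state_law :: "rooted_class pmf \<Rightarrow> bool" where
  "steady_state_law W \<longleftrightarrow>
     explodes_as W \<and> mean_explosion_time W < \<infinity> \<and>
     distr (stationary_measure W) (count_space UNIV) (\<lambda>x. stationary_process x 0) = measure_pmf W"

(* The law of the cluster seen from a uniformly chosen vertex; it does not depend on the
   representative of the class. *)
definition reroot_law :: "rooted_class pmf \<Rightarrow> rooted_class pmf" where
  "reroot_law W =
     bind_pmf W (\<lambda>c. map_pmf (\<lambda>v. abs_rooted_class ((rep_rooted_class c)\<lparr>root := v\<rparr>))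
                        (pmf_of_set {..<nverts (rep_rooted_class c)}))"

end

theory Submission
  imports Defs
begin

text \<open>
  Write \<open>|c|\<close> for the number of vertices of a cluster \<open>c\<close> and \<open>m\<close> for the mean explosion time.

  The law of the stationary process at time \<open>0\<close> gives to \<open>c\<close> the expected time that one growth
  spends in \<open>c\<close>, divided by \<open>m\<close>.  A visit to \<open>c\<close> lasts \<open>1/|c|\<close> on average, so if \<open>W\<close> is a
  steady state law then \<open>m |c| W(c)\<close> is the expected number of visits of the growth chain to \<open>c\<close>.
  Decomposing these visits according to the last attachment gives a closed equation for \<open>W\<close>
  (lemma \<open>steady_state_balance\<close>, in integrated form):

    \<open>|c| W(c) = [c is a single vertex] / m + (\<Sum>a b. W(a) W(b) #{w \<in> a. grafting b at w yields c})\<close>.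

  Re-root invariance follows from this equation alone.  Attach to each cluster \<open>c\<close> and vertex \<open>v\<close>
  a mass \<open>F c v\<close> that depends only on the cluster with its two marked vertices, the root and
  \<open>v\<close>.  The claim is that the total \<open>\<Sum>c. W(c) (\<Sum>v \<in> c. F c v)\<close> does not change when
  the two marks are exchanged (lemma \<open>mass_transport\<close>).  It is proved for the clusters of size \<open>n\<close>,
  by induction on \<open>n\<close>.  The balance equation writes such a cluster as \<open>a\<close>, containing the root,
  joined by an edge from one of its vertices \<open>w\<close> to the root of \<open>b\<close>.

    \<^item> If \<open>v\<close> lies in \<open>a\<close>, the induction hypothesis for \<open>a\<close>, with \<open>b\<close> fixed, exchanges the root
      and \<open>v\<close>.

    \<^item> If \<open>v\<close> lies in \<open>b\<close>, the induction hypothesis for \<open>a\<close> exchanges the root of \<open>a\<close> and the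
      attachment vertex \<open>w\<close>.  After that, \<open>a\<close> and \<open>b\<close> are joined by an edge between their roots and
      carry the marks \<open>w\<close> and \<open>v\<close> respectively.  Exchanging the marks is now the same as
      exchanging the roles of \<open>a\<close> and \<open>b\<close>, which have the same weight \<open>W(a) W(b)\<close>.

  Re-root invariance at a class \<open>d\<close> is the case in which \<open>F c v\<close> is \<open>1/|c|\<close> if \<open>c\<close> rooted at
  \<open>v\<close> belongs to \<open>d\<close>, and \<open>0\<close> otherwise.
\<close>

section \<open>Isomorphisms of rooted graphs and grafting\<close>

definition rooted_isom :: "(nat \<Rightarrow> nat) \<Rightarrow> rgraph \<Rightarrow> rgraph \<Rightarrow> bool" where
  "rooted_isom f G H \<longleftrightarrow> rooted_graph G \<and> rooted_graph H \<and>
     bij_betw f {..<nverts G} {..<nverts H} \<and>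
     edges H = (\<lambda>e. f ` e) ` edges G \<and> f (root G) = root H"

lemma rooted_iso_iff: "rooted_iso G H \<longleftrightarrow> (\<exists>f. rooted_isom f G H)"
  unfolding rooted_iso_def rooted_isom_def by blast

lemma rooted_graph_rep: "rooted_graph (rep_rooted_class c)"
proof -
  have "rooted_iso (rep_rooted_class c) (rep_rooted_class c)"
    using Quotient_rep_reflp[OF Quotient_rooted_class] .
  then show ?thesis unfolding rooted_iso_def by blast
qed

lemma abs_rep_rooted_class: "abs_rooted_class (rep_rooted_class c) = c"
  using Quotient_abs_rep[OF Quotient_rooted_class] .

lemma rep_abs_rooted_iso: "rooted_graph G \<Longrightarrow> rooted_iso (rep_rooted_class (abs_rooted_class G)) G"
  using Quotient_rep_abs[OF Quotient_rooted_class rooted_iso_refl] .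

lemma abs_rooted_class_eqI: "rooted_iso G H \<Longrightarrow> abs_rooted_class G = abs_rooted_class H"
  using Quotient_rel_abs[OF Quotient_rooted_class] .

lemma rooted_graph_reroot: "rooted_graph G \<Longrightarrow> v < nverts G \<Longrightarrow> rooted_graph (G\<lparr>root := v\<rparr>)"
  by (simp add: rooted_graph_def)

lemma rooted_isom_reroot:
  assumes "rooted_isom f G H" "v < nverts G"
  shows "rooted_isom f (G\<lparr>root := v\<rparr>) (H\<lparr>root := f v\<rparr>)"
proof -
  have "f v < nverts H"
    using assms unfolding rooted_isom_def by (auto dest: bij_betwE)
  then show ?thesis
    using assms by (auto simp: rooted_isom_def rooted_graph_reroot)
qed

lemma rooted_graph_singleton: "rooted_graph singleton_graph"
  by (simp add: rooted_graph_def singleton_graph_def)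

lemma nverts_graft [simp]: "nverts (graft G w C) = nverts G + nverts C"
  and root_graft [simp]: "root (graft G w C) = root G"
  by (simp_all add: graft_def)

lemma graft_reroot: "graft (G\<lparr>root := v\<rparr>) w C = (graft G w C)\<lparr>root := v\<rparr>"
  by (simp add: graft_def)

lemma rooted_graph_graft:
  assumes G: "rooted_graph G" and C: "rooted_graph C" and w: "w < nverts G"
  shows "rooted_graph (graft G w C)"
proof -
  have "e \<subseteq> {..<nverts G + nverts C} \<and> card e = 2" if e: "e \<in> edges (graft G w C)" for e
  proof -
    consider "e \<in> edges G" | e' where "e' \<in> edges C" "e = (\<lambda>x. nverts G + x) ` e'"
      | "e = {w, nverts G + root C}"
      using e unfolding graft_def by auto
    then show ?thesis
    proof cases
      case 1
      with G show ?thesis by (force simp: rooted_graph_def)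
    next
      case 2
      then have "e' \<subseteq> {..<nverts C}" "card e' = 2"
        using C by (auto simp: rooted_graph_def)
      with 2 show ?thesis by (auto simp: card_image)
    next
      case 3
      with w C show ?thesis by (auto simp: rooted_graph_def)
    qed
  qed
  with G show ?thesis by (auto simp: rooted_graph_def)
qed

lemma bij_betw_append:
  fixes f g :: "nat \<Rightarrow> nat"
  assumes "bij_betw f {..<a} {..<a'}" "bij_betw g {..<b} {..<b'}"
  shows "bij_betw (\<lambda>x. if x < a then f x else a' + g (x - a)) {..<a + b} {..<a' + b'}"
proof -
  have "bij_betw (\<lambda>x. a' + g (x - a)) {a..<a+b} {a'..<a'+b'}"
  proof -
    have "bij_betw (\<lambda>x. x - a) {a..<a+b} {..<b}"
      by (rule bij_betw_byWitness[where f' = "\<lambda>x. x + a"]) auto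
    moreover have "bij_betw (\<lambda>x. a' + x) {..<b'} {a'..<a'+b'}"
      by (rule bij_betw_byWitness[where f' = "\<lambda>x. x - a'"]) auto
    ultimately have "bij_betw ((\<lambda>x. a' + x) \<circ> (g \<circ> (\<lambda>x. x - a))) {a..<a+b} {a'..<a'+b'}"
      using assms(2) by (blast intro: bij_betw_trans)
    then show ?thesis by (simp add: comp_def)
  qed
  with assms(1) have "bij_betw (\<lambda>x. if x \<in> {..<a} then f x else a' + g (x - a))
      ({..<a} \<union> {a..<a+b}) ({..<a'} \<union> {a'..<a'+b'})"
    by (intro bij_betw_disjoint_Un) auto
  then show ?thesis
    by (simp add: ivl_disj_un)
qed

lemma rooted_isom_graft:
  assumes f: "rooted_isom f G G'" and g: "rooted_isom g C C'" and w: "w < nverts G"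
  shows "rooted_isom (\<lambda>x. if x < nverts G then f x else nverts G' + g (x - nverts G))
           (graft G w C) (graft G' (f w) C')"
    (is "rooted_isom ?h _ _")
proof -
  have G: "rooted_graph G" "rooted_graph G'" and C: "rooted_graph C" "rooted_graph C'"
    using f g by (auto simp: rooted_isom_def)
  have w': "f w < nverts G'"
    using f w by (auto simp: rooted_isom_def dest: bij_betwE)
  define h where "h = ?h"
  have old: "(\<lambda>e. h ` e) ` edges G = edges G'"
  proof -
    have "h ` e = f ` e" if "e \<in> edges G" for e
      using G(1) that unfolding h_def by (intro image_cong) (auto simp: rooted_graph_def)
    then show ?thesis using f by (simp add: rooted_isom_def)
  qed
  have "h ` (\<lambda>x. nverts G + x) ` e = (\<lambda>x. nverts G' + x) ` g ` e" for e
    unfolding h_def image_image by simp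
  then have new: "(\<lambda>e. h ` e) ` (\<lambda>e. (\<lambda>x. nverts G + x) ` e) ` edges C =
      (\<lambda>e. (\<lambda>x. nverts G' + x) ` e) ` edges C'"
    using g by (simp add: rooted_isom_def image_image)
  have "h ` {w, nverts G + root C} = {f w, nverts G' + root C'}"
    using g w by (auto simp: h_def rooted_isom_def)
  then have join: "(\<lambda>e. h ` e) ` {{w, nverts G + root C}} = {{f w, nverts G' + root C'}}"
    by simp
  have "edges (graft G' (f w) C') = (\<lambda>e. h ` e) ` edges (graft G w C)"
    unfolding graft_def rgraph.select_convs image_Un old new join ..
  moreover have "root G < nverts G"
    using G by (simp add: rooted_graph_def)
  ultimately show ?thesis
    using f g w w' G C unfolding rooted_isom_def h_def
    by (auto intro: bij_betw_append rooted_graph_graft)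
qed

text \<open>
  The edge that joins two graphs at their roots has no preferred direction, so grafting either one on
  the other gives the same graph up to the labels and the choice of the root.
\<close>
lemma rooted_isom_graft_swap:
  assumes G: "rooted_graph G" and C: "rooted_graph C" and v: "v < nverts C"
  shows "rooted_isom (\<lambda>x. if x < nverts G then nverts C + x else x - nverts G)
           ((graft G (root G) C)\<lparr>root := nverts G + v\<rparr>) (graft (C\<lparr>root := v\<rparr>) (root C) G)"
    (is "rooted_isom ?h ?L ?R")
proof -
  define h where "h = ?h"
  have root: "root G < nverts G" "root C < nverts C"
    using G C by (simp_all add: rooted_graph_def)
  have "h ` e = (\<lambda>x. nverts C + x) ` e" if "e \<in> edges G" for e
    using G that unfolding h_def by (intro image_cong) (auto simp: rooted_graph_def)
  then have old: "(\<lambda>e. h ` e) ` edges G = (\<lambda>e. (\<lambda>x. nverts C + x) ` e) ` edges G"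
    by simp
  have "h ` (\<lambda>x. nverts G + x) ` e = e" for e
    unfolding h_def image_image by simp
  then have new: "(\<lambda>e. h ` e) ` (\<lambda>e. (\<lambda>x. nverts G + x) ` e) ` edges C = edges C"
    by (simp add: image_image)
  have "h ` {root G, nverts G + root C} = {root C, nverts C + root G}"
    using root by (auto simp: h_def)
  then have join: "(\<lambda>e. h ` e) ` {{root G, nverts G + root C}} = {{root C, nverts C + root G}}"
    by simp
  have "edges ?R = (\<lambda>e. h ` e) ` edges ?L"
    unfolding graft_def rgraph.select_convs rgraph.update_convs image_Un old new join
    by (simp add: Un_commute)
  then have "edges ?R = (\<lambda>e. ?h ` e) ` edges ?L"
    by (simp only: h_def)
  moreover have "bij_betw ?h {..<nverts ?L} {..<nverts ?R}"
    by (rule bij_betw_byWitness[where f' = "\<lambda>x. if x < nverts C then nverts G + x else x - nverts C"])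
       auto
  moreover have "rooted_graph ?L" "rooted_graph ?R"
    using G C v root by (auto intro!: rooted_graph_graft rooted_graph_reroot)
  ultimately show ?thesis
    using v by (simp add: rooted_isom_def)
qed

text \<open>
  A function of a rooted graph and a vertex which depends only on the isomorphism class of the
  graph with two marked vertices.
\<close>
definition birooted_invariant :: "(rgraph \<Rightarrow> nat \<Rightarrow> ennreal) \<Rightarrow> bool" where
  "birooted_invariant F \<longleftrightarrow>
     (\<forall>f G H v. rooted_isom f G H \<longrightarrow> v < nverts G \<longrightarrow> F G v = F H (f v))"

definition swap_roots :: "(rgraph \<Rightarrow> nat \<Rightarrow> ennreal) \<Rightarrow> rgraph \<Rightarrow> nat \<Rightarrow> ennreal" where
  "swap_roots F G v = F (G\<lparr>root := v\<rparr>) (root G)"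

definition vertex_sum :: "(rgraph \<Rightarrow> nat \<Rightarrow> ennreal) \<Rightarrow> rgraph \<Rightarrow> ennreal" where
  "vertex_sum F G = (\<Sum>v<nverts G. F G v)"

lemma birooted_invariantD:
  "birooted_invariant F \<Longrightarrow> rooted_isom f G H \<Longrightarrow> v < nverts G \<Longrightarrow> F G v = F H (f v)"
  by (auto simp: birooted_invariant_def)

lemma birooted_invariant_swap_roots:
  assumes "birooted_invariant F"
  shows "birooted_invariant (swap_roots F)"
  unfolding birooted_invariant_def
proof (intro allI impI)
  fix f G H v assume *: "rooted_isom f G H" "v < nverts G"
  then have "root G < nverts (G\<lparr>root := v\<rparr>)" "f (root G) = root H"
    by (auto simp: rooted_isom_def rooted_graph_def)
  with birooted_invariantD[OF assms rooted_isom_reroot[OF *]]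
  show "swap_roots F G v = swap_roots F H (f v)"
    by (simp add: swap_roots_def)
qed

lemma vertex_sum_isom:
  assumes F: "birooted_invariant F" and f: "rooted_isom f G H"
  shows "vertex_sum F G = vertex_sum F H"
proof -
  have "vertex_sum F G = (\<Sum>v<nverts G. F H (f v))"
    unfolding vertex_sum_def by (rule sum.cong) (auto simp: birooted_invariantD[OF F f])
  also have "\<dots> = vertex_sum F H"
    unfolding vertex_sum_def using f by (intro sum.reindex_bij_betw) (simp add: rooted_isom_def)
  finally show ?thesis .
qed

definition class_size :: "rooted_class \<Rightarrow> nat" where
  "class_size c = nverts (rep_rooted_class c)"

lemma class_size_abs: "rooted_graph G \<Longrightarrow> class_size (abs_rooted_class G) = nverts G"
  using rep_abs_rooted_iso[of G] unfolding class_size_def rooted_iso_def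
  by (metis bij_betw_same_card card_lessThan)

lemma vertex_sum_rep_abs:
  assumes "birooted_invariant F" "rooted_graph G"
  shows "vertex_sum F (rep_rooted_class (abs_rooted_class G)) = vertex_sum F G"
  using rep_abs_rooted_iso[OF assms(2)] vertex_sum_isom[OF assms(1)]
  unfolding rooted_iso_iff by blast

lemma class_size_pos: "0 < class_size c"
  using rooted_graph_rep[of c] by (auto simp: class_size_def rooted_graph_def)

lemma class_size_neq_0 [simp]: "class_size c \<noteq> 0"
  using class_size_pos[of c] by simp

section \<open>Exchanging the two marked vertices\<close>

lemma nn_integral_pmf_commute:
  fixes f :: "'a \<Rightarrow> 'b \<Rightarrow> ennreal"
  shows "(\<integral>\<^sup>+a. \<integral>\<^sup>+b. f a b \<partial>measure_pmf B \<partial>measure_pmf A) =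
     (\<integral>\<^sup>+b. \<integral>\<^sup>+a. f a b \<partial>measure_pmf A \<partial>measure_pmf B)"
proof -
  have "(\<integral>\<^sup>+a. \<integral>\<^sup>+b. f a b \<partial>measure_pmf B \<partial>measure_pmf A) =
      (\<integral>\<^sup>+x. f (fst x) (snd x) \<partial>measure_pmf (pair_pmf A B))"
    by (simp add: nn_integral_pair_pmf')
  also have "\<dots> = (\<integral>\<^sup>+b. \<integral>\<^sup>+a. f a b \<partial>measure_pmf A \<partial>measure_pmf B)"
    by (subst pair_commute_pmf) (simp add: case_prod_beta nn_integral_pair_pmf')
  finally show ?thesis .
qed

lemma sum_lessThan_add:
  fixes f :: "nat \<Rightarrow> 'a::comm_monoid_add"
  shows "(\<Sum>i<a + b. f i) = (\<Sum>i<a. f i) + (\<Sum>i<b. f (a + i))"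
  by (induction b) (simp_all add: ac_simps)

lemma vertex_sum_graft:
  "vertex_sum F (graft G w C) =
     (\<Sum>v<nverts G. F (graft G w C) v) + (\<Sum>v<nverts C. F (graft G w C) (nverts G + v))"
  unfolding vertex_sum_def nverts_graft by (rule sum_lessThan_add)

text \<open>
  Once \<open>C\<close> is fixed, a functional of the grafted graph in which both marks lie in \<open>G\<close> becomes, when
  summed over the attachment vertex, an invariant functional of \<open>G\<close>.  This is what lets the induction
  hypothesis act on \<open>G\<close>; the exchange of marks commutes with the grafting.
\<close>
lemma swap_roots_vertex_sum_near:
  assumes F: "birooted_invariant F" and C: "rooted_graph C"
  defines "H \<equiv> \<lambda>G v. \<Sum>w<nverts G. F (graft G w C) v"
  shows "birooted_invariant H"
    and "swap_roots H G v = (\<Sum>w<nverts G. swap_roots F (graft G w C) v)"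
proof -
  show "birooted_invariant H"
    unfolding birooted_invariant_def
  proof (intro allI impI)
    fix f G G' v assume f: "rooted_isom f G G'" and v: "v < nverts G"
    have "rooted_isom id C C"
      using C by (simp add: rooted_isom_def)
    note iso = rooted_isom_graft[OF f this]
    have "H G v = (\<Sum>w<nverts G. F (graft G' (f w) C) (f v))"
      unfolding H_def using birooted_invariantD[OF F iso] v by (intro sum.cong) auto
    also have "\<dots> = H G' (f v)"
      unfolding H_def using f by (intro sum.reindex_bij_betw) (simp add: rooted_isom_def)
    finally show "H G v = H G' (f v)" .
  qed
  show "swap_roots H G v = (\<Sum>w<nverts G. swap_roots F (graft G w C) v)"
    by (simp add: H_def swap_roots_def graft_reroot)
qed

text \<open>
  Here the second mark lies in \<open>C\<close>, and the attachment vertex \<open>w\<close> takes the place of the second mark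
  of \<open>G\<close>.  Exchanging it with the root of \<open>G\<close> attaches \<open>C\<close> at the old root of \<open>G\<close> and makes \<open>w\<close> the root of
  the whole graph.
\<close>
lemma swap_roots_vertex_sum_far:
  assumes F: "birooted_invariant F" and C: "rooted_graph C"
  defines "H \<equiv> \<lambda>G w. \<Sum>v<nverts C. F (graft G w C) (nverts G + v)"
  shows "birooted_invariant H"
    and "swap_roots H G w =
      (\<Sum>v<nverts C. F ((graft G (root G) C)\<lparr>root := w\<rparr>) (nverts G + v))"
proof -
  show "birooted_invariant H"
    unfolding birooted_invariant_def
  proof (intro allI impI)
    fix f G G' w assume f: "rooted_isom f G G'" and w: "w < nverts G"
    have "rooted_isom id C C"
      using C by (simp add: rooted_isom_def)
    note iso = rooted_isom_graft[OF f this w]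
    show "H G w = H G' (f w)"
      unfolding H_def by (intro sum.cong) (auto simp: birooted_invariantD[OF F iso])
  qed
  show "swap_roots H G w =
      (\<Sum>v<nverts C. F ((graft G (root G) C)\<lparr>root := w\<rparr>) (nverts G + v))"
    by (simp add: H_def swap_roots_def graft_reroot)
qed

text \<open>
  With \<open>G\<close> and \<open>C\<close> joined at their roots and one mark in each, exchanging the marks and exchanging the
  two graphs are the same operation.
\<close>
lemma swap_roots_bridge:
  assumes F: "birooted_invariant F" and G: "rooted_graph G" and C: "rooted_graph C"
    and w: "w < nverts G" and v: "v < nverts C"
  shows "swap_roots F ((graft G (root G) C)\<lparr>root := w\<rparr>) (nverts G + v) =
      F ((graft C (root C) G)\<lparr>root := v\<rparr>) (nverts C + w)"
  using birooted_invariantD[OF F rooted_isom_graft_swap[OF G C v], of w] w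
  by (simp add: swap_roots_def graft_reroot)

definition sized_sum :: "rooted_class pmf \<Rightarrow> nat \<Rightarrow> (rgraph \<Rightarrow> nat \<Rightarrow> ennreal) \<Rightarrow> ennreal" where
  "sized_sum W n F =
     (\<integral>\<^sup>+c. (if class_size c = n then vertex_sum F (rep_rooted_class c) else 0) \<partial>measure_pmf W)"

text \<open>
  The constant \<open>\<kappa>\<close> is the mass injected at the single vertex; a cluster with one vertex has only
  one pair of marks, so this term is symmetric whatever \<open>\<kappa>\<close> is.  The balance equation is multiplied
  by the size \<open>n\<close>, which is cancelled at the end.
\<close>
lemma mass_transport:
  fixes W :: "rooted_class pmf" and \<kappa> :: ennreal
  assumes balance: "\<And>f :: rooted_class \<Rightarrow> ennreal.
      (\<integral>\<^sup>+c. of_nat (class_size c) * f c \<partial>measure_pmf W) =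
        \<kappa> * f (abs_rooted_class singleton_graph) +
        (\<integral>\<^sup>+a. \<integral>\<^sup>+b. (\<Sum>w<class_size a.
           f (abs_rooted_class (graft (rep_rooted_class a) w (rep_rooted_class b))))
           \<partial>measure_pmf W \<partial>measure_pmf W)"
    and "birooted_invariant F"
  shows "sized_sum W n (swap_roots F) = sized_sum W n F"
  using \<open>birooted_invariant F\<close>
proof (induction n arbitrary: F rule: less_induct)
  case (less n)
  let ?rep = rep_rooted_class
  let ?I = "\<lambda>h. \<integral>\<^sup>+a. \<integral>\<^sup>+b. (if class_size a + class_size b = n then h (?rep a) (?rep b) else 0)
      \<partial>measure_pmf W \<partial>measure_pmf W"
  \<comment> \<open>The contributions to the balance equation in which the second mark lies in the old part and in
    the new part; \<open>bridge\<close> is the form in which the second one is symmetric.\<close>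
  define near where "near F = ?I (\<lambda>G C. \<Sum>w<nverts G. \<Sum>v<nverts G. F (graft G w C) v)"
    for F :: "rgraph \<Rightarrow> nat \<Rightarrow> ennreal"
  define far where "far F = ?I (\<lambda>G C. \<Sum>w<nverts G. \<Sum>v<nverts C. F (graft G w C) (nverts G + v))"
    for F :: "rgraph \<Rightarrow> nat \<Rightarrow> ennreal"
  define bridge where "bridge F = ?I (\<lambda>G C. \<Sum>w<nverts G. \<Sum>v<nverts C.
      F ((graft G (root G) C)\<lparr>root := w\<rparr>) (nverts G + v))"
    for F :: "rgraph \<Rightarrow> nat \<Rightarrow> ennreal"
  have commute: "?I h = (\<integral>\<^sup>+b. \<integral>\<^sup>+a. (if class_size a + class_size b = n then h (?rep a) (?rep b) else 0)
      \<partial>measure_pmf W \<partial>measure_pmf W)" for h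
    by (rule nn_integral_pmf_commute)
  \<comment> \<open>Fixing the grafted class \<open>b\<close> leaves the classes \<open>a\<close> of size \<open>n - |b|\<close>, which is less than \<open>n\<close> since
    clusters are nonempty.\<close>
  have I_sized_sum: "?I (\<lambda>G C. vertex_sum (H C) G) =
      (\<integral>\<^sup>+b. (if class_size b \<le> n then sized_sum W (n - class_size b) (H (?rep b)) else 0) \<partial>measure_pmf W)"
    for H
    unfolding commute[of "\<lambda>G C. vertex_sum (H C) G"] sized_sum_def
    by (intro nn_integral_cong) (auto intro!: nn_integral_cong)
  have IH: "?I (\<lambda>G C. vertex_sum (swap_roots (H C)) G) = ?I (\<lambda>G C. vertex_sum (H C) G)"
    if "\<And>C. rooted_graph C \<Longrightarrow> birooted_invariant (H C)" for H
  proof -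
    have "sized_sum W (n - class_size b) (swap_roots (H (?rep b))) =
        sized_sum W (n - class_size b) (H (?rep b))" if "class_size b \<le> n" for b
      using that class_size_pos[of b] \<open>\<And>C. rooted_graph C \<Longrightarrow> birooted_invariant (H C)\<close>[OF rooted_graph_rep]
      by (intro less.IH) auto
    then show ?thesis
      unfolding I_sized_sum[of H] I_sized_sum[of "\<lambda>C. swap_roots (H C)"]
      by (intro nn_integral_cong) auto
  qed
  have cong: "?I h = ?I h'"
    if "\<And>G C. rooted_graph G \<Longrightarrow> rooted_graph C \<Longrightarrow> h G C = h' G C" for h h'
    using that rooted_graph_rep by (intro nn_integral_cong) auto
  have decompose: "of_nat n * sized_sum W n F =
      \<kappa> * (if n = 1 then F singleton_graph 0 else 0) + near F + far F"
    if F: "birooted_invariant F" for F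
  proof -
    let ?f = "\<lambda>c. if class_size c = n then vertex_sum F (?rep c) else 0"
    have f_single: "?f (abs_rooted_class singleton_graph) = (if n = 1 then F singleton_graph 0 else 0)"
      using vertex_sum_rep_abs[OF F rooted_graph_singleton] class_size_abs[OF rooted_graph_singleton]
      by (simp add: vertex_sum_def singleton_graph_def)
    have f_graft: "(\<Sum>w<class_size a. ?f (abs_rooted_class (graft (?rep a) w (?rep b)))) =
       (if class_size a + class_size b = n then
          (\<Sum>w<nverts (?rep a). \<Sum>v<nverts (?rep a). F (graft (?rep a) w (?rep b)) v) else 0) +
       (if class_size a + class_size b = n then
          (\<Sum>w<nverts (?rep a). \<Sum>v<nverts (?rep b). F (graft (?rep a) w (?rep b)) (nverts (?rep a) + v)) else 0)"
      for a b
    proof -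
      have "?f (abs_rooted_class (graft (?rep a) w (?rep b))) =
          (if class_size a + class_size b = n then (\<Sum>v<nverts (?rep a). F (graft (?rep a) w (?rep b)) v) +
             (\<Sum>v<nverts (?rep b). F (graft (?rep a) w (?rep b)) (nverts (?rep a) + v)) else 0)"
        if "w < class_size a" for w
      proof -
        have w: "w < nverts (?rep a)"
          using that by (simp add: class_size_def)
        note graft = rooted_graph_graft[OF rooted_graph_rep rooted_graph_rep w]
        show ?thesis
          unfolding vertex_sum_rep_abs[OF F graft] class_size_abs[OF graft] vertex_sum_graft
          by (simp add: class_size_def)
      qed
      then show ?thesis
        by (simp add: sum.distrib class_size_def)
    qed
    have "of_nat n * sized_sum W n F = (\<integral>\<^sup>+c. of_nat (class_size c) * ?f c \<partial>measure_pmf W)"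
      unfolding sized_sum_def
      by (subst nn_integral_cmult[symmetric]) (auto intro!: nn_integral_cong)
    also have "\<dots> = \<kappa> * (if n = 1 then F singleton_graph 0 else 0) + near F + far F"
      unfolding balance f_single f_graft near_def far_def
      by (simp add: nn_integral_add add.assoc)
    finally show ?thesis .
  qed
  have near: "near (swap_roots F) = near F" if F: "birooted_invariant F" for F
  proof -
    define H where "H C = (\<lambda>G v. \<Sum>w<nverts G. F (graft G w C) v)" for C
    have "near F = ?I (\<lambda>G C. vertex_sum (H C) G)"
      unfolding near_def vertex_sum_def H_def by (rule cong) (rule sum.swap)
    also have "\<dots> = ?I (\<lambda>G C. vertex_sum (swap_roots (H C)) G)"
      unfolding H_def by (rule IH[symmetric]) (rule swap_roots_vertex_sum_near(1)[OF F])
    also have "\<dots> = near (swap_roots F)"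
      unfolding near_def vertex_sum_def H_def
      by (rule cong) (subst sum.swap, simp add: swap_roots_vertex_sum_near(2)[OF F])
    finally show ?thesis ..
  qed
  have far: "far F = bridge F" if F: "birooted_invariant F" for F
  proof -
    define H where "H C = (\<lambda>G w. \<Sum>v<nverts C. F (graft G w C) (nverts G + v))" for C
    have "far F = ?I (\<lambda>G C. vertex_sum (H C) G)"
      unfolding far_def vertex_sum_def H_def ..
    also have "\<dots> = ?I (\<lambda>G C. vertex_sum (swap_roots (H C)) G)"
      unfolding H_def by (rule IH[symmetric]) (rule swap_roots_vertex_sum_far(1)[OF F])
    also have "\<dots> = bridge F"
      unfolding bridge_def vertex_sum_def H_def
      by (rule cong) (simp add: swap_roots_vertex_sum_far(2)[OF F])
    finally show ?thesis .
  qed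
  have bridge: "bridge (swap_roots F) = bridge F" if F: "birooted_invariant F" for F
  proof -
    have "bridge (swap_roots F) = ?I (\<lambda>G C. \<Sum>v<nverts C. \<Sum>w<nverts G.
        F ((graft C (root C) G)\<lparr>root := v\<rparr>) (nverts C + w))"
      unfolding bridge_def
      by (rule cong) (subst sum.swap, simp add: swap_roots_bridge[OF F])
    also have "\<dots> = bridge F"
      unfolding bridge_def by (subst commute) (simp add: add.commute)
    finally show ?thesis .
  qed
  have "swap_roots F singleton_graph 0 = F singleton_graph 0"
    by (simp add: swap_roots_def singleton_graph_def)
  then have "of_nat n * sized_sum W n (swap_roots F) = of_nat n * sized_sum W n F"
    unfolding decompose[OF less.prems] decompose[OF birooted_invariant_swap_roots[OF less.prems]]
    using near[OF less.prems] far[OF less.prems] bridge[OF less.prems]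
      far[OF birooted_invariant_swap_roots[OF less.prems]] by simp
  then show ?case
    by (cases "n = 0") (auto simp: sized_sum_def ennreal_mult_cancel_left ennreal_of_nat_eq_real_of_nat)
qed

text \<open>
  Let the root of each cluster send out mass one, spread uniformly over the vertices \<open>v\<close>, and count what
  goes to those \<open>v\<close> at which the re-rooted cluster belongs to \<open>d\<close>.  The expected mass sent by the root is
  the re-rooted law at \<open>d\<close>.  The root receives mass one in total if its cluster belongs to \<open>d\<close> and
  nothing otherwise, so the expected mass received is the original law at \<open>d\<close>.
\<close>
lemma reroot_law_eq_if_balance:
  fixes W :: "rooted_class pmf" and \<kappa> :: ennreal
  assumes balance: "\<And>f :: rooted_class \<Rightarrow> ennreal.
      (\<integral>\<^sup>+c. of_nat (class_size c) * f c \<partial>measure_pmf W) =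
        \<kappa> * f (abs_rooted_class singleton_graph) +
        (\<integral>\<^sup>+a. \<integral>\<^sup>+b. (\<Sum>w<class_size a.
           f (abs_rooted_class (graft (rep_rooted_class a) w (rep_rooted_class b))))
           \<partial>measure_pmf W \<partial>measure_pmf W)"
  shows "reroot_law W = W"
proof (rule pmf_eqI)
  fix d
  let ?n = "class_size d"
  define F :: "rgraph \<Rightarrow> nat \<Rightarrow> ennreal" where
    "F G v = (if abs_rooted_class (G\<lparr>root := v\<rparr>) = d then 1 / of_nat (nverts G) else 0)" for G v
  have F: "birooted_invariant F"
    unfolding birooted_invariant_def
  proof (intro allI impI)
    fix f G H v assume f: "rooted_isom f G H" and v: "v < nverts G"
    have "rooted_iso (G\<lparr>root := v\<rparr>) (H\<lparr>root := f v\<rparr>)"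
      using rooted_isom_reroot[OF f v] rooted_iso_iff by blast
    moreover have "nverts G = nverts H"
      using f unfolding rooted_isom_def by (metis bij_betw_same_card card_lessThan)
    ultimately show "F G v = F H (f v)"
      by (simp add: F_def abs_rooted_class_eqI)
  qed
  have size_reroot: "class_size (abs_rooted_class ((rep_rooted_class c)\<lparr>root := v\<rparr>)) = class_size c"
    if "v < class_size c" for c v
    using class_size_abs[OF rooted_graph_reroot[OF rooted_graph_rep]] that
    by (simp add: class_size_def)
  have "emeasure (measure_pmf (reroot_law W)) {d} = sized_sum W ?n F"
  proof -
    have "emeasure (measure_pmf (map_pmf (\<lambda>v. abs_rooted_class ((rep_rooted_class c)\<lparr>root := v\<rparr>))
        (pmf_of_set {..<nverts (rep_rooted_class c)}))) {d} =
        (if class_size c = ?n then vertex_sum F (rep_rooted_class c) else 0)" (is "?P = _") for c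
    proof -
      have ne: "{..<nverts (rep_rooted_class c)} \<noteq> {}"
        using class_size_pos[of c] by (auto simp: class_size_def)
      have "?P = (\<integral>\<^sup>+v. indicator {d} (abs_rooted_class ((rep_rooted_class c)\<lparr>root := v\<rparr>))
          \<partial>measure_pmf (pmf_of_set {..<nverts (rep_rooted_class c)}))"
        by (subst nn_integral_indicator[symmetric]) simp_all
      also have "\<dots> = vertex_sum F (rep_rooted_class c)"
      proof -
        have "F (rep_rooted_class c) v = indicator {d} (abs_rooted_class ((rep_rooted_class c)\<lparr>root := v\<rparr>)) *
            inverse (of_nat (nverts (rep_rooted_class c)))" for v
          by (simp add: F_def divide_ennreal_def)
        then show ?thesis
          using ne
          by (subst nn_integral_pmf_of_set)
            (simp_all only: vertex_sum_def divide_ennreal_def sum_distrib_right card_lessThan finite_lessThan not_False_eq_True)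
      qed
      also have "\<dots> = (if class_size c = ?n then vertex_sum F (rep_rooted_class c) else 0)"
        using size_reroot[of _ c] by (auto simp: vertex_sum_def F_def class_size_def)
      finally show ?thesis .
    qed
    then show ?thesis
      by (simp add: reroot_law_def sized_sum_def emeasure_bind_pmf)
  qed
  also have "\<dots> = sized_sum W ?n (swap_roots F)"
    by (rule mass_transport[OF balance F, symmetric])
  also have "\<dots> = emeasure (measure_pmf W) {d}"
  proof -
    have "(if class_size c = ?n then vertex_sum (swap_roots F) (rep_rooted_class c) else 0) =
        indicator {d} c" for c
    proof -
      have "vertex_sum (swap_roots F) (rep_rooted_class c) = of_nat (class_size c) *
          (if c = d then 1 / of_nat (class_size c) else 0)"
        by (simp add: vertex_sum_def swap_roots_def F_def abs_rep_rooted_class class_size_def)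
      then show ?thesis
        using class_size_pos[of c] by (auto simp: ennreal_times_divide ennreal_divide_self of_nat_less_top)
    qed
    then show ?thesis
      by (simp add: sized_sum_def)
  qed
  finally show "pmf (reroot_law W) d = pmf W d"
    by (simp add: emeasure_pmf_single)
qed

section \<open>Measurability of the growth process and of the stationary process\<close>

definition finite_edge_graphs :: "rgraph set" where
  "finite_edge_graphs = {G. finite (edges G) \<and> (\<forall>e\<in>edges G. finite e)}"

text \<open>
  Graphs on an infinite set of labels form an uncountable type, but the growth chain takes values in
  this countable set whatever the driving variables are, also for those outside the support of their
  law.  Every function of the chain is therefore measurable.
\<close>
lemma countable_finite_edge_graphs: "countable finite_edge_graphs"
proof -
  let ?E = "{E. finite E \<and> E \<subseteq> Collect finite} :: nat set set set"
  have "countable ?E"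
    by (intro countable_Collect_finite_subset countable_Collect_finite)
  then have "countable ((\<lambda>(n, E, r). \<lparr>nverts = n, edges = E, root = r\<rparr>) ` (UNIV \<times> ?E \<times> UNIV))"
    by (intro countable_image countable_SIGMA) auto
  moreover have "finite_edge_graphs \<subseteq> (\<lambda>(n, E, r). \<lparr>nverts = n, edges = E, root = r\<rparr>) ` (UNIV \<times> ?E \<times> UNIV)"
  proof
    fix G assume "G \<in> finite_edge_graphs"
    then have "(nverts G, edges G, root G) \<in> UNIV \<times> ?E \<times> UNIV"
      by (auto simp: finite_edge_graphs_def)
    moreover have "G = (\<lambda>(n, E, r). \<lparr>nverts = n, edges = E, root = r\<rparr>) (nverts G, edges G, root G)"
      by simp
    ultimately show "G \<in> (\<lambda>(n, E, r). \<lparr>nverts = n, edges = E, root = r\<rparr>) ` (UNIV \<times> ?E \<times> UNIV)"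
      by (rule rev_image_eqI)
  qed
  ultimately show ?thesis
    by (rule countable_subset[rotated])
qed

lemma rooted_graph_finite_edges: "rooted_graph G \<Longrightarrow> G \<in> finite_edge_graphs"
proof -
  assume G: "rooted_graph G"
  then have "edges G \<subseteq> Pow {..<nverts G}"
    by (auto simp: rooted_graph_def)
  then show ?thesis
    by (auto simp: finite_edge_graphs_def intro: finite_subset)
qed

instance rooted_class :: countable
proof
  have "rep_rooted_class ` UNIV \<subseteq> finite_edge_graphs"
    using rooted_graph_finite_edges rooted_graph_rep by blast
  then have "countable (rep_rooted_class ` UNIV)"
    using countable_finite_edge_graphs countable_subset by blast
  moreover have "inj rep_rooted_class"
    by (rule inj_on_inverseI[where g = abs_rooted_class]) (simp add: abs_rep_rooted_class)
  ultimately have "countable (UNIV :: rooted_class set)"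
    using countable_image_inj_on by blast
  then show "\<exists>f :: rooted_class \<Rightarrow> nat. inj f"
    by (rule countableE) blast
qed

lemma graft_finite_edge_graphs:
  "G \<in> finite_edge_graphs \<Longrightarrow> C \<in> finite_edge_graphs \<Longrightarrow> graft G w C \<in> finite_edge_graphs"
  by (auto simp: finite_edge_graphs_def graft_def)

lemma growth_chain_finite_edge_graphs: "growth_chain \<omega> n \<in> finite_edge_graphs"
proof (induction n)
  case 0
  show ?case by (simp add: finite_edge_graphs_def singleton_graph_def)
next
  case (Suc n)
  then show ?case
    by (auto simp: case_prod_beta intro!: graft_finite_edge_graphs rooted_graph_finite_edges[OF rooted_graph_rep])
qed

lemma nverts_growth_chain_pos: "0 < nverts (growth_chain \<omega> n)"
  by (induction n) (auto simp: singleton_graph_def case_prod_beta)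

abbreviation growth_space :: "(nat \<Rightarrow> step) measure" where
  "growth_space \<equiv> Pi\<^sub>M UNIV (\<lambda>_. count_space UNIV \<Otimes>\<^sub>M (borel \<Otimes>\<^sub>M borel))"

lemma measurable_graft_uniform:
  assumes "G \<in> M \<rightarrow>\<^sub>M count_space finite_edge_graphs"
    and [measurable]: "c \<in> M \<rightarrow>\<^sub>M count_space UNIV" "u \<in> borel_measurable M"
  shows "(\<lambda>x. graft (G x) (nat \<lfloor>u x * real (nverts (G x))\<rfloor>) (rep_rooted_class (c x)))
           \<in> M \<rightarrow>\<^sub>M count_space finite_edge_graphs"
proof (rule measurable_compose_countable'[OF _ assms(1) countable_finite_edge_graphs])
  fix H assume H: "H \<in> finite_edge_graphs"
  have "(\<lambda>x. graft H (nat \<lfloor>u x * real (nverts H)\<rfloor>) (rep_rooted_class C)) \<in> M \<rightarrow>\<^sub>M count_space finite_edge_graphs" for C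
  proof (rule measurable_compose_countable[where g = "\<lambda>x. nat \<lfloor>u x * real (nverts H)\<rfloor>"
        and f = "\<lambda>i x. graft H i (rep_rooted_class C)"])
    show "(\<lambda>x. nat \<lfloor>u x * real (nverts H)\<rfloor>) \<in> M \<rightarrow>\<^sub>M count_space UNIV"
      by measurable
    show "(\<lambda>x. graft H i (rep_rooted_class C)) \<in> M \<rightarrow>\<^sub>M count_space finite_edge_graphs" for i
      using H by (simp add: graft_finite_edge_graphs rooted_graph_finite_edges rooted_graph_rep)
  qed
  then show "(\<lambda>x. graft H (nat \<lfloor>u x * real (nverts H)\<rfloor>) (rep_rooted_class (c x))) \<in> M \<rightarrow>\<^sub>M count_space finite_edge_graphs"
    by (rule measurable_compose_countable[where g = c and
          f = "\<lambda>C x. graft H (nat \<lfloor>u x * real (nverts H)\<rfloor>) (rep_rooted_class C)"]) fact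
qed

lemma measurable_growth_chain: "(\<lambda>\<omega>. growth_chain \<omega> n) \<in> growth_space \<rightarrow>\<^sub>M count_space finite_edge_graphs"
proof (induction n)
  case 0
  show ?case
    using growth_chain_finite_edge_graphs[of _ 0] by simp
next
  case (Suc n)
  have "(\<lambda>\<omega>. graft (growth_chain \<omega> n) (nat \<lfloor>fst (snd (\<omega> n)) * real (nverts (growth_chain \<omega> n))\<rfloor>)
      (rep_rooted_class (fst (\<omega> n)))) \<in> growth_space \<rightarrow>\<^sub>M count_space finite_edge_graphs"
    by (rule measurable_graft_uniform[OF Suc]) measurable
  then show ?case
    by (simp add: case_prod_beta)
qed

lemma measurable_growth_chain_compose:
  assumes "f \<in> M \<rightarrow>\<^sub>M growth_space" "\<And>G. h G \<in> space N"
  shows "(\<lambda>x. h (growth_chain (f x) n)) \<in> M \<rightarrow>\<^sub>M N"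
proof -
  have "h \<in> count_space finite_edge_graphs \<rightarrow>\<^sub>M N"
    using assms(2) by simp
  from measurable_compose[OF measurable_compose[OF assms(1) measurable_growth_chain] this]
  show ?thesis .
qed

lemma measurable_growth_chain_count_space [measurable]:
  "f \<in> M \<rightarrow>\<^sub>M growth_space \<Longrightarrow> (\<lambda>x. h (growth_chain (f x) n)) \<in> M \<rightarrow>\<^sub>M count_space UNIV"
  by (rule measurable_growth_chain_compose) simp_all

lemma measurable_waiting_time [measurable]:
  "(\<lambda>\<omega>. waiting_time \<omega> n) \<in> borel_measurable growth_space"
  unfolding waiting_time_def case_prod_beta by measurable

lemma measurable_jump_time [measurable]:
  "(\<lambda>\<omega>. jump_time \<omega> n) \<in> borel_measurable growth_space"
  unfolding jump_time_def by measurable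

lemma measurable_explosion_time [measurable]: "explosion_time \<in> borel_measurable growth_space"
  unfolding explosion_time_def[abs_def] by measurable

lemma measurable_lifetime [measurable]: "lifetime \<in> borel_measurable growth_space"
  unfolding lifetime_def[abs_def] by measurable

lemma measurable_growth_process [measurable (raw)]:
  assumes [measurable]: "f \<in> M \<rightarrow>\<^sub>M growth_space" "t \<in> borel_measurable M"
  shows "(\<lambda>x. growth_process (f x) (t x)) \<in> M \<rightarrow>\<^sub>M count_space UNIV"
  unfolding growth_process_def
proof (rule measurable_compose_countable[where g = "\<lambda>x. LEAST n. t x < jump_time (f x) (Suc n)"
      and f = "\<lambda>n x. abs_rooted_class (growth_chain (f x) n)"])
  have [measurable]: "(\<lambda>x. jump_time (f x) n) \<in> borel_measurable M" for n
    by (rule measurable_compose[OF assms(1) measurable_jump_time])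
  show "(\<lambda>x. LEAST n. t x < jump_time (f x) (Suc n)) \<in> M \<rightarrow>\<^sub>M count_space UNIV"
    by measurable
  show "(\<lambda>x. abs_rooted_class (growth_chain (f x) n)) \<in> M \<rightarrow>\<^sub>M count_space UNIV" for n
    by measurable
qed

text \<open>
  A set of integers may have no least element, and then the operator returns a fixed unspecified
  value.  The events below separate the two cases.
\<close>
lemma measurable_Least_int:
  fixes P :: "'a \<Rightarrow> int \<Rightarrow> bool"
  assumes [measurable]: "\<And>k. Measurable.pred M (\<lambda>x. P x k)"
  shows "(\<lambda>x. LEAST k. P x k) \<in> M \<rightarrow>\<^sub>M count_space UNIV"
proof -
  let ?Q = "\<lambda>x k. P x k \<and> (\<forall>j. P x j \<longrightarrow> k \<le> j)"
  have eq: "(LEAST k. P x k) = k \<longleftrightarrow> ?Q x k \<or> (\<forall>j. \<not> ?Q x j) \<and> k = (THE j :: int. False)" for x k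
  proof (cases "\<exists>j. ?Q x j")
    case True
    then obtain j where j: "?Q x j" by blast
    then have "(LEAST k. P x k) = j"
      by (intro Least_equality) auto
    moreover have "i = j" if "?Q x i" for i
      using j that by (meson order_antisym)
    ultimately show ?thesis using j by blast
  next
    case False
    then have none: "?Q x i \<longleftrightarrow> False" for i by simp
    have "(LEAST k. P x k) = (THE j :: int. False)"
      unfolding Least_def none ..
    then show ?thesis by (simp only: none simp_thms eq_commute[of k])
  qed
  have "Measurable.pred M (\<lambda>x. (LEAST k. P x k) = k)" for k
    unfolding eq by measurable
  then have "{x \<in> space M. (LEAST k. P x k) = k} \<in> sets M" for k
    by (rule predE)
  then show ?thesis
    unfolding measurable_count_space_eq2_countable
    by (simp add: vimage_def Int_def conj_commute)
qed

abbreviation stationary_space :: "((int \<Rightarrow> nat \<Rightarrow> step) \<times> real) measure" where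
  "stationary_space \<equiv> Pi\<^sub>M UNIV (\<lambda>_. growth_space) \<Otimes>\<^sub>M borel"

lemma measurable_start_time [measurable]: "(\<lambda>x. start_time x k) \<in> borel_measurable stationary_space"
proof -
  have [measurable]: "(\<lambda>x. lifetime (fst x i)) \<in> borel_measurable stationary_space" for i
    by (rule measurable_compose[OF _ measurable_lifetime]) measurable
  show ?thesis
    unfolding start_time_def case_prod_beta by measurable
qed

lemma measurable_stationary_process:
  "(\<lambda>x. stationary_process x t) \<in> stationary_space \<rightarrow>\<^sub>M count_space UNIV"
  unfolding stationary_process_def Let_def
proof (rule measurable_compose_countable[
      where g = "\<lambda>x. LEAST k. start_time x k \<le> t \<and> t < start_time x (k + 1)"
      and f = "\<lambda>k x. growth_process (fst x k) (t - start_time x k)"])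
  show "(\<lambda>x. LEAST k. start_time x k \<le> t \<and> t < start_time x (k + 1)) \<in> stationary_space \<rightarrow>\<^sub>M count_space UNIV"
    by (rule measurable_Least_int) measurable
  show "(\<lambda>x. growth_process (fst x k) (t - start_time x k)) \<in> stationary_space \<rightarrow>\<^sub>M count_space UNIV" for k
    by measurable
qed

section \<open>One step of the growth chain\<close>

abbreviation step_space :: "step measure" where
  "step_space \<equiv> count_space UNIV \<Otimes>\<^sub>M (borel \<Otimes>\<^sub>M borel)"

lemma sets_step_measure [measurable_cong, simp]: "sets (step_measure W) = sets step_space"
  unfolding step_measure_def by (intro sets_pair_measure_cong) simp_all

lemma sets_growth_measure [measurable_cong, simp]: "sets (growth_measure W) = sets growth_space"
  unfolding growth_measure_def by (intro sets_PiM_cong) simp_all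

lemma prob_space_uniform_unit: "prob_space (uniform_measure lborel {0..<1::real})"
  by (rule prob_space_uniform_measure) simp_all

lemma prob_space_unit_exponential: "prob_space (density lborel (\<lambda>x. ennreal (exponential_density 1 x)))"
  using prob_space_exponential_density[of 1] by simp

lemma prob_space_step_measure: "prob_space (step_measure W)"
  unfolding step_measure_def
  by (intro prob_space_pair measure_pmf.prob_space_axioms prob_space_uniform_unit prob_space_unit_exponential)

lemma nn_integral_step_measure:
  assumes [measurable]: "f \<in> borel_measurable step_space"
  shows "(\<integral>\<^sup>+s. f s \<partial>step_measure W) =
    (\<integral>\<^sup>+c. \<integral>\<^sup>+u. \<integral>\<^sup>+e. f (c, u, e) \<partial>density lborel (\<lambda>x. ennreal (exponential_density 1 x))
       \<partial>uniform_measure lborel {0..<1} \<partial>measure_pmf W)"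
proof -
  interpret U: prob_space "uniform_measure lborel {0..<1::real}"
    by (rule prob_space_uniform_unit)
  interpret E: prob_space "density lborel (\<lambda>x. ennreal (exponential_density 1 x))"
    by (rule prob_space_unit_exponential)
  interpret UE: pair_prob_space "uniform_measure lborel {0..<1::real}"
      "density lborel (\<lambda>x. ennreal (exponential_density 1 x))" ..
  have [measurable]: "(\<lambda>p. f (c, p)) \<in> borel_measurable (borel \<Otimes>\<^sub>M borel)" for c
    by measurable
  have "(\<integral>\<^sup>+s. f s \<partial>step_measure W) =
      (\<integral>\<^sup>+c. \<integral>\<^sup>+p. f (c, p) \<partial>(uniform_measure lborel {0..<1} \<Otimes>\<^sub>M
         density lborel (\<lambda>x. ennreal (exponential_density 1 x))) \<partial>measure_pmf W)"
    unfolding step_measure_def by (rule UE.nn_integral_fst[symmetric]) measurable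
  also have "\<dots> = (\<integral>\<^sup>+c. \<integral>\<^sup>+u. \<integral>\<^sup>+e. f (c, u, e) \<partial>density lborel (\<lambda>x. ennreal (exponential_density 1 x))
       \<partial>uniform_measure lborel {0..<1} \<partial>measure_pmf W)"
    by (intro nn_integral_cong E.nn_integral_fst[symmetric]) measurable
  finally show ?thesis .
qed

lemma nn_integral_unit_exponential:
  "(\<integral>\<^sup>+e. ennreal e \<partial>density lborel (\<lambda>x. ennreal (exponential_density 1 x))) = 1"
proof -
  have "(\<integral>\<^sup>+e. ennreal e \<partial>density lborel (\<lambda>x. ennreal (exponential_density 1 x))) =
      (\<integral>\<^sup>+x. ennreal (erlang_density 0 1 x * x ^ 1) \<partial>lborel)"
    by (subst nn_integral_density) (auto simp: ennreal_mult'[symmetric] erlang_density_def intro!: nn_integral_cong)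
  also have "\<dots> = 1"
    by (subst nn_integral_erlang_ith_moment) simp_all
  finally show ?thesis .
qed

lemma nn_integral_uniform_floor:
  fixes g :: "nat \<Rightarrow> ennreal"
  assumes k: "0 < k"
  shows "(\<integral>\<^sup>+u. g (nat \<lfloor>u * real k\<rfloor>) \<partial>uniform_measure lborel {0..<1}) = (\<Sum>w<k. g w) / of_nat k"
proof -
  \<comment> \<open>The unit interval splits into \<open>k\<close> cells of length \<open>1/k\<close> on which the integrand is constant.\<close>
  have cell: "u \<in> {0..<1} \<and> nat \<lfloor>u * real k\<rfloor> = w \<longleftrightarrow> u \<in> {real w / real k..<real (w + 1) / real k}"
    if "w < k" for u w
  proof -
    have "u \<in> {0..<1} \<and> nat \<lfloor>u * real k\<rfloor> = w \<longleftrightarrow> 0 \<le> u * real k \<and> u * real k < real k \<and> \<lfloor>u * real k\<rfloor> = int w"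
      using k by (auto simp: zero_le_mult_iff)
    also have "\<dots> \<longleftrightarrow> real w \<le> u * real k \<and> u * real k < real (w + 1)"
    proof -
      have "real w + 1 \<le> real k" using that by linarith
      then show ?thesis
        unfolding floor_eq_iff of_int_of_nat_eq of_nat_add of_nat_1 by safe linarith+
    qed
    also have "\<dots> \<longleftrightarrow> u \<in> {real w / real k..<real (w + 1) / real k}"
      using k by (auto simp: field_simps)
    finally show ?thesis .
  qed
  have floor_less: "nat \<lfloor>u * real k\<rfloor> < k" if "u \<in> {0..<1}" for u :: real
  proof -
    have "u * real k < real k" "0 \<le> u * real k" using that k by auto
    then show ?thesis by linarith
  qed
  have "(\<integral>\<^sup>+u. g (nat \<lfloor>u * real k\<rfloor>) \<partial>uniform_measure lborel {0..<1}) =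
      (\<integral>\<^sup>+u. g (nat \<lfloor>u * real k\<rfloor>) * indicator {0..<1} u \<partial>lborel)"
    by (subst nn_integral_uniform_measure) (simp_all add: divide_ennreal_def)
  also have "\<dots> = (\<integral>\<^sup>+u. (\<Sum>w<k. g w * indicator {real w / real k..<real (w + 1) / real k} u) \<partial>lborel)"
  proof (intro nn_integral_cong)
    fix u :: real
    have "indicator {real w / real k..<real (w + 1) / real k} u =
        (if nat \<lfloor>u * real k\<rfloor> = w then indicator {0..<1} u else 0 :: ennreal)" if "w < k" for w
      unfolding indicator_def cell[OF that, symmetric] by simp
    then have "(\<Sum>w<k. g w * indicator {real w / real k..<real (w + 1) / real k} u) =
        (\<Sum>w<k. if nat \<lfloor>u * real k\<rfloor> = w then g w * indicator {0..<1} u else 0)"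
      by (intro sum.cong) auto
    also have "\<dots> = g (nat \<lfloor>u * real k\<rfloor>) * indicator {0..<1} u"
      using floor_less[of u] by (auto simp: indicator_def)
    finally show "g (nat \<lfloor>u * real k\<rfloor>) * indicator {0..<1} u =
        (\<Sum>w<k. g w * indicator {real w / real k..<real (w + 1) / real k} u)" ..
  qed
  also have "\<dots> = (\<Sum>w<k. g w * ennreal (1 / real k))"
  proof (subst nn_integral_sum)
    have "emeasure lborel {real w / real k..<real (w + 1) / real k} = ennreal (1 / real k)" for w
      using k by (simp add: divide_right_mono flip: diff_divide_distrib)
    then show "(\<Sum>w<k. \<integral>\<^sup>+u. g w * indicator {real w / real k..<real (w + 1) / real k} u \<partial>lborel) =
        (\<Sum>w<k. g w * ennreal (1 / real k))"
      by (subst nn_integral_cmult_indicator) simp_all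
  qed simp
  also have "\<dots> = (\<Sum>w<k. g w) / of_nat k"
    using k by (simp add: sum_distrib_right[symmetric] divide_ennreal_def ennreal_of_nat_eq_real_of_nat
        inverse_ennreal inverse_eq_divide)
  finally show ?thesis .
qed

lemma growth_chain_cong: "(\<And>i. i < n \<Longrightarrow> \<omega> i = \<omega>' i) \<Longrightarrow> growth_chain \<omega> n = growth_chain \<omega>' n"
  by (induction n) auto

text \<open>
  Markov property of the growth chain: step \<open>n\<close> is independent of the first \<open>n\<close> steps, which
  determine the chain at time \<open>n\<close>.  The sequence is cut at \<open>n\<close> and continued by an independent copy.
\<close>
lemma nn_integral_growth_step:
  fixes h :: "rgraph \<Rightarrow> step \<Rightarrow> ennreal"
  assumes meas [measurable]:
    "(\<lambda>x. h (growth_chain (fst x) n) (snd x)) \<in> borel_measurable (growth_space \<Otimes>\<^sub>M step_space)"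
  shows "(\<integral>\<^sup>+\<omega>. h (growth_chain \<omega> n) (\<omega> n) \<partial>growth_measure W) =
    (\<integral>\<^sup>+\<omega>. \<integral>\<^sup>+s. h (growth_chain \<omega> n) s \<partial>step_measure W \<partial>growth_measure W)"
proof -
  interpret sequence_space "step_measure W"
    unfolding sequence_space_def by (rule product_prob_spaceI) (rule prob_space_step_measure)
  interpret G: prob_space "growth_measure W"
    unfolding growth_measure_def by (rule prob_space_PiM) (rule prob_space_step_measure)
  have S: "S = growth_measure W"
    by (simp add: growth_measure_def)
  have [measurable]: "(\<lambda>\<omega>. h (growth_chain \<omega> n) (\<omega> n)) \<in> borel_measurable growth_space"
    using measurable_compose[OF _ meas, of "\<lambda>\<omega>. (\<omega>, \<omega> n)" growth_space] by simp
  have [measurable]: "(\<lambda>x. h (growth_chain (fst x) n) (snd x 0)) \<in> borel_measurable (growth_space \<Otimes>\<^sub>M growth_space)"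
    using measurable_compose[OF _ meas, of "\<lambda>x. (fst x, snd x 0)" "growth_space \<Otimes>\<^sub>M growth_space"] by simp
  have [measurable]: "(\<lambda>s. h (growth_chain \<omega> n) s) \<in> borel_measurable step_space" for \<omega>
    using measurable_compose[OF measurable_Pair1'[of \<omega> growth_space] meas]
    by (simp add: space_PiM space_pair_measure)
  have "(\<integral>\<^sup>+\<omega>. h (growth_chain \<omega> n) (\<omega> n) \<partial>growth_measure W) =
      (\<integral>\<^sup>+\<omega>. h (growth_chain \<omega> n) (\<omega> n)
        \<partial>distr (growth_measure W \<Otimes>\<^sub>M growth_measure W) (growth_measure W) (\<lambda>(\<omega>, \<omega>'). comb_seq n \<omega> \<omega>'))"
    using PiM_comb_seq[of n] unfolding S by simp
  also have "\<dots> = (\<integral>\<^sup>+x. h (growth_chain (fst x) n) (snd x 0) \<partial>(growth_measure W \<Otimes>\<^sub>M growth_measure W))"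
  proof (subst nn_integral_distr)
    show "(\<lambda>(\<omega>, \<omega>'). comb_seq n \<omega> \<omega>') \<in> growth_measure W \<Otimes>\<^sub>M growth_measure W \<rightarrow>\<^sub>M growth_measure W"
      using measurable_comb_seq[of n "step_measure W"] unfolding S .
    have "growth_chain (comb_seq n \<omega> \<omega>') n = growth_chain \<omega> n" for \<omega> \<omega>' :: "nat \<Rightarrow> step"
      by (rule growth_chain_cong) (simp add: comb_seq_less)
    moreover have "comb_seq n \<omega> \<omega>' n = \<omega>' 0" for \<omega> \<omega>' :: "nat \<Rightarrow> step"
      using comb_seq_add[of n \<omega> \<omega>' 0] by simp
    ultimately show "(\<integral>\<^sup>+x. h (growth_chain (case x of (\<omega>, \<omega>') \<Rightarrow> comb_seq n \<omega> \<omega>') n)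
          ((case x of (\<omega>, \<omega>') \<Rightarrow> comb_seq n \<omega> \<omega>') n) \<partial>(growth_measure W \<Otimes>\<^sub>M growth_measure W)) =
        (\<integral>\<^sup>+x. h (growth_chain (fst x) n) (snd x 0) \<partial>(growth_measure W \<Otimes>\<^sub>M growth_measure W))"
      by (simp add: case_prod_beta)
  qed measurable
  also have "\<dots> = (\<integral>\<^sup>+\<omega>. \<integral>\<^sup>+\<omega>'. h (growth_chain \<omega> n) (\<omega>' 0) \<partial>growth_measure W \<partial>growth_measure W)"
    by (subst G.nn_integral_fst[symmetric]) simp_all
  also have "\<dots> = (\<integral>\<^sup>+\<omega>. \<integral>\<^sup>+s. h (growth_chain \<omega> n) s \<partial>step_measure W \<partial>growth_measure W)"
  proof (intro nn_integral_cong)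
    fix \<omega>
    have "(\<integral>\<^sup>+s. h (growth_chain \<omega> n) s \<partial>step_measure W) =
        (\<integral>\<^sup>+s. h (growth_chain \<omega> n) s \<partial>distr (growth_measure W) (step_measure W) (\<lambda>\<omega>'. \<omega>' 0))"
      using PiM_component[of 0] by (simp add: growth_measure_def)
    also have "\<dots> = (\<integral>\<^sup>+\<omega>'. h (growth_chain \<omega> n) (\<omega>' 0) \<partial>growth_measure W)"
      by (subst nn_integral_distr) simp_all
    finally show "(\<integral>\<^sup>+\<omega>'. h (growth_chain \<omega> n) (\<omega>' 0) \<partial>growth_measure W) =
        (\<integral>\<^sup>+s. h (growth_chain \<omega> n) s \<partial>step_measure W)" ..
  qed
  finally show ?thesis .
qed

section \<open>Sample paths of the growth process\<close>

text \<open>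
  Off a null set the uniform variables select existing vertices and all waiting times are positive.
\<close>
definition regular :: "(nat \<Rightarrow> step) \<Rightarrow> bool" where
  "regular \<omega> \<longleftrightarrow> (\<forall>n. fst (snd (\<omega> n)) \<in> {0..<1} \<and> 0 < snd (snd (\<omega> n)))"

lemma AE_regular: "AE \<omega> in growth_measure W. regular \<omega>"
proof -
  have "AE s in step_measure W. fst (snd s) \<in> {0..<1} \<and> 0 < snd (snd s)"
  proof -
    interpret U: prob_space "uniform_measure lborel {0..<1::real}"
      by (rule prob_space_uniform_unit)
    interpret E: prob_space "density lborel (\<lambda>x. ennreal (exponential_density 1 x))"
      by (rule prob_space_unit_exponential)
    interpret UE: pair_prob_space "uniform_measure lborel {0..<1::real}"
        "density lborel (\<lambda>x. ennreal (exponential_density 1 x))" ..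
    interpret W: pair_prob_space "measure_pmf W" "uniform_measure lborel {0..<1::real} \<Otimes>\<^sub>M
        density lborel (\<lambda>x. ennreal (exponential_density 1 x))" ..
    have u: "AE u in uniform_measure lborel {0..<1::real}. u \<in> {0..<1}"
      by (rule AE_uniform_measureI) auto
    have e: "AE e in density lborel (\<lambda>x. ennreal (exponential_density 1 x)). 0 < e"
      using AE_lborel_singleton[of "0::real"]
      by (subst AE_density) (auto simp: exponential_density_def elim!: eventually_mono)
    have "AE p in uniform_measure lborel {0..<1::real} \<Otimes>\<^sub>M
        density lborel (\<lambda>x. ennreal (exponential_density 1 x)). fst p \<in> {0..<1} \<and> 0 < snd p"
    proof (rule UE.AE_pair_measure)
      show "AE u in uniform_measure lborel {0..<1::real}.
          AE e in density lborel (\<lambda>x. ennreal (exponential_density 1 x)).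
            fst (u, e) \<in> {0..<1} \<and> 0 < snd (u, e)"
        using u by eventually_elim (use e in auto)
    qed measurable
    then have "AE c in measure_pmf W. AE p in uniform_measure lborel {0..<1::real} \<Otimes>\<^sub>M
        density lborel (\<lambda>x. ennreal (exponential_density 1 x)).
          fst (snd (c, p)) \<in> {0..<1} \<and> 0 < snd (snd (c, p))"
      by simp
    then show ?thesis
      unfolding step_measure_def by (rule W.AE_pair_measure[rotated]) measurable
  qed
  then have "AE \<omega> in growth_measure W. fst (snd (\<omega> n)) \<in> {0..<1} \<and> 0 < snd (snd (\<omega> n))" for n
    unfolding growth_measure_def by (intro AE_PiM_component prob_space_step_measure) auto
  then show ?thesis
    unfolding regular_def AE_all_countable by blast
qed

lemma rooted_graph_growth_chain:
  assumes "regular \<omega>"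
  shows "rooted_graph (growth_chain \<omega> n)"
proof (induction n)
  case 0
  show ?case by (simp add: rooted_graph_singleton)
next
  case (Suc n)
  let ?k = "nverts (growth_chain \<omega> n)" and ?u = "fst (snd (\<omega> n))"
  have "0 \<le> ?u" "?u < 1"
    using assms by (auto simp: regular_def)
  then have "0 \<le> ?u * real ?k" "?u * real ?k < real ?k"
    using nverts_growth_chain_pos[of \<omega> n] by auto
  then have "nat \<lfloor>?u * real ?k\<rfloor> < ?k"
    by linarith
  then show ?case
    using Suc by (auto simp: case_prod_beta intro!: rooted_graph_graft rooted_graph_rep)
qed

lemma waiting_time_pos: "regular \<omega> \<Longrightarrow> 0 < waiting_time \<omega> n"
  using nverts_growth_chain_pos[of \<omega> n] by (auto simp: waiting_time_def regular_def case_prod_beta)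

lemma jump_time_0 [simp]: "jump_time \<omega> 0 = 0"
  and jump_time_Suc: "jump_time \<omega> (Suc n) = jump_time \<omega> n + waiting_time \<omega> n"
  by (simp_all add: jump_time_def)

lemma jump_time_nonneg: "regular \<omega> \<Longrightarrow> 0 \<le> jump_time \<omega> n"
  unfolding jump_time_def by (intro sum_nonneg less_imp_le waiting_time_pos)

lemma jump_time_mono: "regular \<omega> \<Longrightarrow> m \<le> n \<Longrightarrow> jump_time \<omega> m \<le> jump_time \<omega> n"
  by (rule lift_Suc_mono_le) (simp_all add: jump_time_Suc waiting_time_pos less_imp_le)

lemma explosion_time_eq_SUP:
  assumes "regular \<omega>"
  shows "explosion_time \<omega> = (SUP n. ennreal (jump_time \<omega> n))"
proof -
  have "incseq (\<lambda>n. ennreal (jump_time \<omega> n))"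
    using assms by (auto simp: incseq_def intro!: ennreal_leI jump_time_mono)
  from limI[OF LIMSEQ_SUP[OF this]] show ?thesis
    by (simp add: explosion_time_def)
qed

lemma lifetime_bounds:
  assumes \<omega>: "regular \<omega>" and finite: "explosion_time \<omega> < \<infinity>"
  shows "explosion_time \<omega> = ennreal (lifetime \<omega>)"
    and "jump_time \<omega> n < lifetime \<omega>"
    and "t < lifetime \<omega> \<Longrightarrow> \<exists>n. t < jump_time \<omega> n"
proof -
  show T: "explosion_time \<omega> = ennreal (lifetime \<omega>)"
    unfolding lifetime_def using finite by (intro ennreal_enn2real[symmetric]) simp
  have nonneg: "0 \<le> lifetime \<omega>"
    by (simp add: lifetime_def)
  have "ennreal (jump_time \<omega> (Suc n)) \<le> ennreal (lifetime \<omega>)"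
    unfolding T[symmetric] explosion_time_eq_SUP[OF \<omega>] by (rule SUP_upper) simp
  then have "jump_time \<omega> (Suc n) \<le> lifetime \<omega>"
    using nonneg by simp
  then show "jump_time \<omega> n < lifetime \<omega>"
    using waiting_time_pos[OF \<omega>, of n] by (simp add: jump_time_Suc)
  show "\<exists>n. t < jump_time \<omega> n" if "t < lifetime \<omega>"
  proof (rule ccontr)
    assume "\<not> ?thesis"
    then have "jump_time \<omega> n \<le> t" for n by (simp add: not_less)
    then have "ennreal (lifetime \<omega>) \<le> ennreal t"
      unfolding T[symmetric] explosion_time_eq_SUP[OF \<omega>] by (intro SUP_least ennreal_leI)
    moreover have "0 \<le> t"
      using \<open>\<And>n. jump_time \<omega> n \<le> t\<close>[of 0] by simp
    ultimately show False
      using that by simp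
  qed
qed

lemma growth_process_eq:
  assumes \<omega>: "regular \<omega>" and t: "jump_time \<omega> n \<le> t" "t < jump_time \<omega> (Suc n)"
  shows "growth_process \<omega> t = abs_rooted_class (growth_chain \<omega> n)"
proof -
  have "(LEAST n. t < jump_time \<omega> (Suc n)) = n"
  proof (rule Least_equality)
    fix m assume "t < jump_time \<omega> (Suc m)"
    then have "\<not> Suc m \<le> n"
      using t(1) jump_time_mono[OF \<omega>, of "Suc m" n] by linarith
    then show "n \<le> m" by simp
  qed fact
  then show ?thesis
    by (simp add: growth_process_def)
qed

text \<open>
  Size-biasing by the lifetime followed by a uniform choice inside the lifetime amounts to
  integrating over time.  The path is constant between jumps, so the integral is a sum over the
  states of the chain weighted by their waiting times.
\<close>
lemma time_integral_growth_process:
  fixes f :: "rooted_class \<Rightarrow> ennreal"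
  assumes \<omega>: "regular \<omega>" and finite: "explosion_time \<omega> < \<infinity>"
  shows "explosion_time \<omega> *
      (\<integral>\<^sup>+u. f (growth_process \<omega> (u * lifetime \<omega>)) \<partial>uniform_measure lborel {0..<1}) =
    (\<Sum>n. f (abs_rooted_class (growth_chain \<omega> n)) * ennreal (waiting_time \<omega> n))"
proof -
  let ?T = "lifetime \<omega>" and ?J = "jump_time \<omega>"
  note bounds = lifetime_bounds[OF \<omega> finite]
  have T: "0 < ?T"
    using bounds(2)[of 0] by simp
  have [measurable]: "(\<lambda>t. f (growth_process \<omega> (g t))) \<in> borel_measurable borel"
    if [measurable]: "g \<in> borel_measurable borel" for g :: "real \<Rightarrow> real"
  proof -
    have "(\<lambda>t. growth_process \<omega> (g t)) \<in> borel \<rightarrow>\<^sub>M count_space UNIV"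
      by (rule measurable_growth_process) (simp_all add: space_PiM space_pair_measure)
    from measurable_compose[OF this, of f borel] show ?thesis by simp
  qed
  have "explosion_time \<omega> * (\<integral>\<^sup>+u. f (growth_process \<omega> (u * ?T)) \<partial>uniform_measure lborel {0..<1}) =
      ennreal ?T * (\<integral>\<^sup>+u. f (growth_process \<omega> (0 + ?T * u)) * indicator {0..<?T} (0 + ?T * u) \<partial>lborel)"
  proof -
    have "indicator {0..<1} u = (indicator {0..<?T} (0 + ?T * u) :: ennreal)" for u :: real
      using T by (auto simp: indicator_def zero_le_mult_iff)
    then show ?thesis
      unfolding bounds(1) by (subst nn_integral_uniform_measure) (simp_all add: divide_ennreal_def mult.commute)
  qed
  also have "\<dots> = (\<integral>\<^sup>+t. f (growth_process \<omega> t) * indicator {0..<?T} t \<partial>lborel)"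
    using T by (subst nn_integral_real_affine[where c = ?T and t = 0]) simp_all
  also have "\<dots> = (\<integral>\<^sup>+t. (\<Sum>n. f (abs_rooted_class (growth_chain \<omega> n)) * indicator {?J n..<?J (Suc n)} t) \<partial>lborel)"
  proof (intro nn_integral_cong)
    fix t
    show "f (growth_process \<omega> t) * indicator {0..<?T} t =
        (\<Sum>n. f (abs_rooted_class (growth_chain \<omega> n)) * indicator {?J n..<?J (Suc n)} t)"
    proof (cases "t \<in> {0..<?T}")
      case True
      define n where "n = (LEAST n. t < ?J (Suc n))"
      obtain m where m: "t < ?J m"
        using bounds(3) True by auto
      then have "t < ?J (Suc m)"
        using jump_time_mono[OF \<omega>, of m "Suc m"] by simp
      then have n: "t < ?J (Suc n)"
        unfolding n_def by (rule LeastI)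
      have n': "?J n \<le> t"
      proof (cases n)
        case 0
        with True show ?thesis by simp
      next
        case (Suc k)
        then have "\<not> t < ?J (Suc k)"
          unfolding n_def by (intro not_less_Least) simp
        with Suc show ?thesis by simp
      qed
      have "t \<notin> {?J k..<?J (Suc k)}" if "k \<noteq> n" for k
      proof (cases "k < n")
        case True
        then show ?thesis using n' jump_time_mono[OF \<omega>, of "Suc k" n] by simp
      next
        case False
        with that show ?thesis using n jump_time_mono[OF \<omega>, of "Suc n" k] by simp
      qed
      then have "(\<Sum>n. f (abs_rooted_class (growth_chain \<omega> n)) * indicator {?J n..<?J (Suc n)} t) =
          (\<Sum>k\<in>{n}. f (abs_rooted_class (growth_chain \<omega> k)) * indicator {?J k..<?J (Suc k)} t)"
        by (intro suminf_finite) auto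
      with True n n' show ?thesis
        by (simp add: growth_process_eq[OF \<omega>])
    next
      case False
      then have "t \<notin> {?J n..<?J (Suc n)}" for n
        using bounds(2)[of "Suc n"] jump_time_nonneg[OF \<omega>, of n] by auto
      with False show ?thesis by simp
    qed
  qed
  also have "\<dots> = (\<Sum>n. f (abs_rooted_class (growth_chain \<omega> n)) * ennreal (waiting_time \<omega> n))"
    using jump_time_mono[OF \<omega>, of n "Suc n" for n]
    by (simp add: nn_integral_suminf nn_integral_cmult_indicator jump_time_Suc)
  finally show ?thesis .
qed

section \<open>The balance equation of the steady state\<close>

lemma prob_space_growth_measure: "prob_space (growth_measure W)"
  unfolding growth_measure_def by (rule prob_space_PiM) (rule prob_space_step_measure)

lemma mean_explosion_time_pos: "0 < mean_explosion_time W"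
proof (rule ccontr)
  interpret G: prob_space "growth_measure W" by (rule prob_space_growth_measure)
  assume "\<not> ?thesis"
  then have "AE \<omega> in growth_measure W. explosion_time \<omega> = 0"
    by (subst nn_integral_0_iff_AE[symmetric]) (simp_all add: mean_explosion_time_def)
  with AE_regular[of W] have "AE \<omega> in growth_measure W. False"
  proof eventually_elim
    case (elim \<omega>)
    have "ennreal (jump_time \<omega> 1) \<le> explosion_time \<omega>"
      unfolding explosion_time_eq_SUP[OF elim(1)] by (rule SUP_upper) simp
    with elim waiting_time_pos[OF elim(1), of 0] show ?case
      by (simp add: jump_time_def)
  qed
  then show False by simp
qed

lemma sets_size_biased_measure [measurable_cong, simp]: "sets (size_biased_measure W) = sets growth_space"
  by (simp add: size_biased_measure_def)

lemma prob_space_size_biased_measure: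
  assumes "mean_explosion_time W < \<infinity>"
  shows "prob_space (size_biased_measure W)"
proof
  have "emeasure (size_biased_measure W) (space (size_biased_measure W)) =
      (\<integral>\<^sup>+\<omega>. 1 \<partial>size_biased_measure W)"
    by simp
  also have "\<dots> = (\<integral>\<^sup>+\<omega>. explosion_time \<omega> / mean_explosion_time W \<partial>growth_measure W)"
    unfolding size_biased_measure_def by (subst nn_integral_density) simp_all
  also have "\<dots> = 1"
    using assms mean_explosion_time_pos[of W]
    by (subst nn_integral_divide) (auto simp: mean_explosion_time_def[symmetric] less_top)
  finally show "emeasure (size_biased_measure W) (space (size_biased_measure W)) = 1" .
qed

lemma sets_stationary_measure [measurable_cong, simp]: "sets (stationary_measure W) = sets stationary_space"
  unfolding stationary_measure_def by (intro sets_pair_measure_cong sets_PiM_cong) simp_all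

text \<open>
  Time \<open>0\<close> lies in the interval of copy \<open>0\<close>, because all copies with negative
  index end at or before the start of copy \<open>0\<close>, at time \<open>- u * lifetime (\<omega> 0)\<close>.
\<close>
lemma stationary_process_0:
  assumes \<omega>: "regular (\<omega> 0)" and finite: "explosion_time (\<omega> 0) < \<infinity>" and u: "u \<in> {0..<1}"
  shows "stationary_process (\<omega>, u) 0 = growth_process (\<omega> 0) (u * lifetime (\<omega> 0))"
proof -
  have nonneg: "0 \<le> lifetime \<omega>'" for \<omega>'
    by (simp add: lifetime_def)
  have L: "0 < lifetime (\<omega> 0)"
    using lifetime_bounds(2)[OF \<omega> finite, of 0] by simp
  have start_0: "start_time (\<omega>, u) 0 = - u * lifetime (\<omega> 0)"
    by (simp add: start_time_def)
  have "(LEAST k. start_time (\<omega>, u) k \<le> 0 \<and> 0 < start_time (\<omega>, u) (k + 1)) = 0"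
  proof (rule Least_equality)
    have "{0..<1::int} = {0}" by auto
    then have "start_time (\<omega>, u) 1 = (1 - u) * lifetime (\<omega> 0)"
      by (simp add: start_time_def algebra_simps)
    then show "start_time (\<omega>, u) 0 \<le> 0 \<and> 0 < start_time (\<omega>, u) (0 + 1)"
      using u L by (simp add: start_0)
    fix k assume k: "start_time (\<omega>, u) k \<le> 0 \<and> 0 < start_time (\<omega>, u) (k + 1)"
    show "0 \<le> k"
    proof (rule ccontr)
      assume "\<not> 0 \<le> k"
      then have "start_time (\<omega>, u) (k + 1) = - (u * lifetime (\<omega> 0)) - (\<Sum>i\<in>{k + 1..<0}. lifetime (\<omega> i))"
        by (simp add: start_time_def)
      also have "\<dots> \<le> 0"
      proof -
        have "0 \<le> u * lifetime (\<omega> 0)" using u nonneg by simp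
        moreover have "0 \<le> (\<Sum>i\<in>{k + 1..<0}. lifetime (\<omega> i))" by (intro sum_nonneg nonneg)
        ultimately show ?thesis by linarith
      qed
      finally show False using k by simp
    qed
  qed
  then show ?thesis
    by (simp add: stationary_process_def start_0)
qed

text \<open>
  The Green function of the growth chain started from a single vertex, tested against \<open>f\<close>.
\<close>
definition expected_visits :: "rooted_class pmf \<Rightarrow> (rooted_class \<Rightarrow> ennreal) \<Rightarrow> ennreal" where
  "expected_visits W f = (\<Sum>n. \<integral>\<^sup>+\<omega>. f (abs_rooted_class (growth_chain \<omega> n)) \<partial>growth_measure W)"

lemma measurable_growth_chain_class [measurable]:
  fixes f :: "rooted_class \<Rightarrow> ennreal"
  shows "(\<lambda>\<omega>. f (abs_rooted_class (growth_chain \<omega> n))) \<in> borel_measurable growth_space"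
  by (rule measurable_growth_chain_compose) simp_all

text \<open>
  The waiting time is an independent unit exponential variable divided by the size of the state.
\<close>
lemma expected_time_in_state:
  fixes f :: "rooted_class \<Rightarrow> ennreal"
  shows "(\<integral>\<^sup>+\<omega>. f (abs_rooted_class (growth_chain \<omega> n)) * ennreal (waiting_time \<omega> n) \<partial>growth_measure W) =
    (\<integral>\<^sup>+\<omega>. f (abs_rooted_class (growth_chain \<omega> n)) / of_nat (class_size (abs_rooted_class (growth_chain \<omega> n)))
      \<partial>growth_measure W)"
proof -
  let ?h = "\<lambda>G (s :: step). f (abs_rooted_class G) * ennreal (snd (snd s) / real (nverts G))"
  have chain: "(\<lambda>x. h (growth_chain (fst x) n)) \<in> borel_measurable (growth_space \<Otimes>\<^sub>M step_space)"
    if "\<And>G. h G \<in> space borel" for h :: "rgraph \<Rightarrow> 'b :: topological_space"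
    using that by (intro measurable_growth_chain_compose) simp_all
  have [measurable]: "(\<lambda>x. f (abs_rooted_class (growth_chain (fst x) n))) \<in> borel_measurable (growth_space \<Otimes>\<^sub>M step_space)"
    "(\<lambda>x. real (nverts (growth_chain (fst x) n))) \<in> borel_measurable (growth_space \<Otimes>\<^sub>M step_space)"
    by (rule chain, simp)+
  have "(\<integral>\<^sup>+\<omega>. f (abs_rooted_class (growth_chain \<omega> n)) * ennreal (waiting_time \<omega> n) \<partial>growth_measure W) =
      (\<integral>\<^sup>+\<omega>. ?h (growth_chain \<omega> n) (\<omega> n) \<partial>growth_measure W)"
    by (simp add: waiting_time_def case_prod_beta)
  also have "\<dots> = (\<integral>\<^sup>+\<omega>. \<integral>\<^sup>+s. ?h (growth_chain \<omega> n) s \<partial>step_measure W \<partial>growth_measure W)"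
    by (rule nn_integral_growth_step) measurable
  also have "\<dots> = (\<integral>\<^sup>+\<omega>. f (abs_rooted_class (growth_chain \<omega> n)) / of_nat (class_size (abs_rooted_class (growth_chain \<omega> n)))
      \<partial>growth_measure W)"
  proof (rule nn_integral_cong_AE, use AE_regular in eventually_elim)
    case (elim \<omega>)
    let ?G = "growth_chain \<omega> n"
    interpret U: prob_space "uniform_measure lborel {0..<1::real}"
      by (rule prob_space_uniform_unit)
    have k: "0 < nverts ?G"
      by (rule nverts_growth_chain_pos)
    have "(\<integral>\<^sup>+e. f (abs_rooted_class ?G) * ennreal (e / real (nverts ?G))
          \<partial>density lborel (\<lambda>x. ennreal (exponential_density 1 x))) =
        (\<integral>\<^sup>+e. f (abs_rooted_class ?G) / of_nat (nverts ?G) * ennreal e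
          \<partial>density lborel (\<lambda>x. ennreal (exponential_density 1 x)))"
    proof (intro nn_integral_cong)
      fix e :: real
      have "ennreal (e / real (nverts ?G)) = ennreal e * ennreal (1 / real (nverts ?G))"
        using ennreal_mult''[of "1 / real (nverts ?G)" e] by simp
      also have "ennreal (1 / real (nverts ?G)) = inverse (of_nat (nverts ?G))"
        using k by (simp add: ennreal_of_nat_eq_real_of_nat inverse_ennreal inverse_eq_divide)
      finally show "f (abs_rooted_class ?G) * ennreal (e / real (nverts ?G)) =
          f (abs_rooted_class ?G) / of_nat (nverts ?G) * ennreal e"
        by (simp add: divide_ennreal_def ac_simps)
    qed
    also have "\<dots> = f (abs_rooted_class ?G) / of_nat (nverts ?G)"
      by (simp add: nn_integral_cmult nn_integral_unit_exponential)
    finally show ?case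
      using U.emeasure_space_1
      by (simp add: nn_integral_step_measure class_size_abs[OF rooted_graph_growth_chain[OF elim]])
  qed
  finally show ?thesis .
qed

text \<open>
  The steady state is the normalised occupation measure of one growth.
\<close>
lemma steady_state_nn_integral:
  fixes f :: "rooted_class \<Rightarrow> ennreal"
  assumes "steady_state_law W"
  shows "(\<integral>\<^sup>+c. f c \<partial>measure_pmf W) =
    expected_visits W (\<lambda>c. f c / of_nat (class_size c)) / mean_explosion_time W"
proof -
  let ?U = "uniform_measure lborel {0..<1::real}" and ?m = "mean_explosion_time W"
  let ?P = "Pi\<^sub>M UNIV (\<lambda>k::int. if k = 0 then size_biased_measure W else growth_measure W)"
  let ?H = "\<lambda>\<omega>. \<integral>\<^sup>+u. f (growth_process \<omega> (u * lifetime \<omega>)) \<partial>?U"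
  have explodes: "AE \<omega> in growth_measure W. explosion_time \<omega> < \<infinity>"
    and m: "?m < \<infinity>"
    and law: "distr (stationary_measure W) (count_space UNIV) (\<lambda>x. stationary_process x 0) = measure_pmf W"
    using assms by (auto simp: steady_state_law_def explodes_as_def)
  interpret U: prob_space ?U
    by (rule prob_space_uniform_unit)
  have prob: "prob_space (if k = 0 then size_biased_measure W else growth_measure W)" for k :: int
    using prob_space_size_biased_measure[OF m] prob_space_growth_measure by simp
  have sets_P: "sets ?P = sets (Pi\<^sub>M UNIV (\<lambda>_::int. growth_space))"
    by (intro sets_PiM_cong) simp_all
  note [measurable_cong] = sets_P
  have X [measurable]: "(\<lambda>x. stationary_process x 0) \<in> stationary_measure W \<rightarrow>\<^sub>M count_space UNIV"
    using measurable_stationary_process by (simp cong: measurable_cong_sets)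
  have H [measurable]: "?H \<in> borel_measurable growth_space"
  proof -
    have "(\<lambda>x. growth_process (fst x) (snd x * lifetime (fst x))) \<in> growth_space \<Otimes>\<^sub>M ?U \<rightarrow>\<^sub>M count_space UNIV"
      by measurable
    from measurable_compose[OF this, of f borel]
    have "(\<lambda>x. f (growth_process (fst x) (snd x * lifetime (fst x)))) \<in> borel_measurable (growth_space \<Otimes>\<^sub>M ?U)"
      by simp
    from U.borel_measurable_nn_integral_fst[OF this] show ?thesis by simp
  qed
  have "(\<integral>\<^sup>+c. f c \<partial>measure_pmf W) = (\<integral>\<^sup>+x. f (stationary_process x 0) \<partial>stationary_measure W)"
    unfolding law[symmetric] by (subst nn_integral_distr) simp_all
  also have "\<dots> = (\<integral>\<^sup>+\<omega>. \<integral>\<^sup>+u. f (stationary_process (\<omega>, u) 0) \<partial>?U \<partial>?P)"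
  proof -
    have "(\<lambda>x. f (stationary_process x 0)) \<in> borel_measurable (?P \<Otimes>\<^sub>M ?U)"
      using measurable_compose[OF X, of f borel] unfolding stationary_measure_def by simp
    from U.nn_integral_fst[OF this] show ?thesis
      unfolding stationary_measure_def by simp
  qed
  also have "\<dots> = (\<integral>\<^sup>+\<omega>. ?H (\<omega> 0) \<partial>?P)"
  proof (rule nn_integral_cong_AE)
    have "AE \<omega> in size_biased_measure W. regular \<omega> \<and> explosion_time \<omega> < \<infinity>"
      unfolding size_biased_measure_def using AE_regular[of W] explodes
      by (subst AE_density) auto
    then have "AE \<omega> in ?P. regular (\<omega> 0) \<and> explosion_time (\<omega> 0) < \<infinity>"
      using prob by (intro AE_PiM_component[where i = "0::int" and
          P = "\<lambda>\<omega>. regular \<omega> \<and> explosion_time \<omega> < \<infinity>"]) simp_all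
    then show "AE \<omega> in ?P. (\<integral>\<^sup>+u. f (stationary_process (\<omega>, u) 0) \<partial>?U) = ?H (\<omega> 0)"
    proof eventually_elim
      case (elim \<omega>)
      have "AE u in ?U. u \<in> {0..<1}"
        by (rule AE_uniform_measureI) auto
      then have "AE u in ?U. f (stationary_process (\<omega>, u) 0) =
          f (growth_process (\<omega> 0) (u * lifetime (\<omega> 0)))"
        by eventually_elim (use elim in \<open>simp only: stationary_process_0\<close>)
      then show ?case
        by (rule nn_integral_cong_AE)
    qed
  qed
  also have "\<dots> = (\<integral>\<^sup>+\<omega>. ?H \<omega> \<partial>size_biased_measure W)"
  proof -
    have "distr ?P (size_biased_measure W) (\<lambda>\<omega>. \<omega> 0) = size_biased_measure W"
      using distr_PiM_component[of UNIV "\<lambda>k::int. if k = 0 then size_biased_measure W else growth_measure W" 0] prob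
      by simp
    then have "(\<integral>\<^sup>+\<omega>. ?H \<omega> \<partial>size_biased_measure W) =
        (\<integral>\<^sup>+\<omega>. ?H \<omega> \<partial>distr ?P (size_biased_measure W) (\<lambda>\<omega>. \<omega> 0))"
      by simp
    also have "\<dots> = (\<integral>\<^sup>+\<omega>. ?H (\<omega> 0) \<partial>?P)"
      by (subst nn_integral_distr) measurable
    finally show ?thesis ..
  qed
  also have "\<dots> = (\<integral>\<^sup>+\<omega>. explosion_time \<omega> / ?m * ?H \<omega> \<partial>growth_measure W)"
    unfolding size_biased_measure_def by (rule nn_integral_density) measurable
  also have "\<dots> = (\<integral>\<^sup>+\<omega>. (\<Sum>n. f (abs_rooted_class (growth_chain \<omega> n)) * ennreal (waiting_time \<omega> n)) / ?m
      \<partial>growth_measure W)"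
  proof (rule nn_integral_cong_AE, use AE_regular[of W] explodes in eventually_elim)
    case (elim \<omega>)
    have "explosion_time \<omega> / ?m * ?H \<omega> = explosion_time \<omega> * ?H \<omega> / ?m"
      by (simp add: divide_ennreal_def ac_simps)
    then show ?case
      by (simp only: time_integral_growth_process[OF elim])
  qed
  also have "\<dots> = (\<Sum>n. \<integral>\<^sup>+\<omega>. f (abs_rooted_class (growth_chain \<omega> n)) * ennreal (waiting_time \<omega> n)
      \<partial>growth_measure W) / ?m"
    by (subst nn_integral_divide) (measurable, simp add: nn_integral_suminf)
  also have "\<dots> = expected_visits W (\<lambda>c. f c / of_nat (class_size c)) / ?m"
    unfolding expected_time_in_state expected_visits_def ..
  finally show ?thesis .
qed

lemma graft_sum_rep_abs:
  fixes f :: "rooted_class \<Rightarrow> ennreal"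
  assumes G: "rooted_graph G" and C: "rooted_graph C"
  shows "(\<Sum>w<class_size (abs_rooted_class G). f (abs_rooted_class (graft (rep_rooted_class (abs_rooted_class G)) w C))) =
    (\<Sum>w<nverts G. f (abs_rooted_class (graft G w C)))"
proof -
  obtain g where g: "rooted_isom g (rep_rooted_class (abs_rooted_class G)) G"
    using rep_abs_rooted_iso[OF G] unfolding rooted_iso_iff by blast
  have "rooted_isom id C C"
    using C by (simp add: rooted_isom_def)
  from rooted_isom_graft[OF g this]
  have "abs_rooted_class (graft (rep_rooted_class (abs_rooted_class G)) w C) = abs_rooted_class (graft G (g w) C)"
    if "w < nverts (rep_rooted_class (abs_rooted_class G))" for w
    using that by (intro abs_rooted_class_eqI) (auto simp: rooted_iso_iff)
  then have "(\<Sum>w<class_size (abs_rooted_class G). f (abs_rooted_class (graft (rep_rooted_class (abs_rooted_class G)) w C))) =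
      (\<Sum>w<nverts (rep_rooted_class (abs_rooted_class G)). f (abs_rooted_class (graft G (g w) C)))"
    by (simp add: class_size_def)
  also have "\<dots> = (\<Sum>w<nverts G. f (abs_rooted_class (graft G w C)))"
    using g by (intro sum.reindex_bij_betw) (simp add: rooted_isom_def)
  finally show ?thesis .
qed

text \<open>
  The class of the next graph depends on the present graph only through its class and the orbit of
  the chosen vertex, so averaging over a uniform vertex gives a transition kernel on classes.
\<close>
lemma growth_chain_transition:
  fixes f :: "rooted_class \<Rightarrow> ennreal"
  shows "(\<integral>\<^sup>+\<omega>. f (abs_rooted_class (growth_chain \<omega> (Suc n))) \<partial>growth_measure W) =
    (\<integral>\<^sup>+\<omega>. (\<lambda>a. (\<integral>\<^sup>+b. (\<Sum>w<class_size a. f (abs_rooted_class (graft (rep_rooted_class a) w (rep_rooted_class b))))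
       \<partial>measure_pmf W) / of_nat (class_size a)) (abs_rooted_class (growth_chain \<omega> n)) \<partial>growth_measure W)"
proof -
  let ?h = "\<lambda>G (s :: step). f (abs_rooted_class
      (graft G (nat \<lfloor>fst (snd s) * real (nverts G)\<rfloor>) (rep_rooted_class (fst s))))"
  have h: "(\<lambda>x. ?h (G x) (s x)) \<in> borel_measurable M"
    if "G \<in> M \<rightarrow>\<^sub>M count_space finite_edge_graphs" and [measurable]: "s \<in> M \<rightarrow>\<^sub>M step_space" for G s and M :: "'b measure"
  proof -
    have "(\<lambda>x. graft (G x) (nat \<lfloor>fst (snd (s x)) * real (nverts (G x))\<rfloor>) (rep_rooted_class (fst (s x))))
        \<in> M \<rightarrow>\<^sub>M count_space finite_edge_graphs"
      by (rule measurable_graft_uniform[OF that(1)]) measurable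
    moreover have "(\<lambda>G. f (abs_rooted_class G)) \<in> borel_measurable (count_space finite_edge_graphs)"
      by simp
    ultimately show ?thesis
      by (rule measurable_compose)
  qed
  have "(\<integral>\<^sup>+\<omega>. f (abs_rooted_class (growth_chain \<omega> (Suc n))) \<partial>growth_measure W) =
      (\<integral>\<^sup>+\<omega>. ?h (growth_chain \<omega> n) (\<omega> n) \<partial>growth_measure W)"
    by (simp add: case_prod_beta)
  also have "\<dots> = (\<integral>\<^sup>+\<omega>. \<integral>\<^sup>+s. ?h (growth_chain \<omega> n) s \<partial>step_measure W \<partial>growth_measure W)"
  proof (rule nn_integral_growth_step[of ?h])
    show "(\<lambda>x. ?h (growth_chain (fst x) n) (snd x)) \<in> borel_measurable (growth_space \<Otimes>\<^sub>M step_space)"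
      by (rule h) (auto intro: measurable_compose[OF measurable_fst measurable_growth_chain])
  qed
  also have "\<dots> = (\<integral>\<^sup>+\<omega>. (\<lambda>a. (\<integral>\<^sup>+b. (\<Sum>w<class_size a. f (abs_rooted_class (graft (rep_rooted_class a) w (rep_rooted_class b))))
       \<partial>measure_pmf W) / of_nat (class_size a)) (abs_rooted_class (growth_chain \<omega> n)) \<partial>growth_measure W)"
  proof (rule nn_integral_cong_AE, use AE_regular in eventually_elim)
    case (elim \<omega>)
    let ?G = "growth_chain \<omega> n"
    interpret E: prob_space "density lborel (\<lambda>x. ennreal (exponential_density 1 x))"
      by (rule prob_space_unit_exponential)
    have "?h ?G \<in> borel_measurable step_space"
      by (rule h) (simp_all add: growth_chain_finite_edge_graphs)
    then have "(\<integral>\<^sup>+s. ?h ?G s \<partial>step_measure W) =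
        (\<integral>\<^sup>+b. \<integral>\<^sup>+u. f (abs_rooted_class (graft ?G (nat \<lfloor>u * real (nverts ?G)\<rfloor>) (rep_rooted_class b)))
          \<partial>uniform_measure lborel {0..<1} \<partial>measure_pmf W)"
      using E.emeasure_space_1 by (subst nn_integral_step_measure) simp_all
    also have "\<dots> = (\<integral>\<^sup>+b. (\<Sum>w<nverts ?G. f (abs_rooted_class (graft ?G w (rep_rooted_class b)))) / of_nat (nverts ?G)
        \<partial>measure_pmf W)"
      using nn_integral_uniform_floor[OF nverts_growth_chain_pos,
          of "\<lambda>w. f (abs_rooted_class (graft ?G w (rep_rooted_class b)))" for b] by simp
    finally show ?case
      unfolding graft_sum_rep_abs[OF rooted_graph_growth_chain[OF elim] rooted_graph_rep]
      unfolding class_size_abs[OF rooted_graph_growth_chain[OF elim]]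
      by (simp add: nn_integral_divide)
  qed
  finally show ?thesis .
qed

lemma expected_visits_recursion:
  fixes f :: "rooted_class \<Rightarrow> ennreal"
  shows "expected_visits W f = f (abs_rooted_class singleton_graph) +
    expected_visits W (\<lambda>a. (\<integral>\<^sup>+b. (\<Sum>w<class_size a.
       f (abs_rooted_class (graft (rep_rooted_class a) w (rep_rooted_class b)))) \<partial>measure_pmf W) / of_nat (class_size a))"
proof -
  interpret G: prob_space "growth_measure W" by (rule prob_space_growth_measure)
  have "expected_visits W f = (\<Sum>n. \<integral>\<^sup>+\<omega>. f (abs_rooted_class (growth_chain \<omega> (Suc n))) \<partial>growth_measure W) +
      (\<integral>\<^sup>+\<omega>. f (abs_rooted_class (growth_chain \<omega> 0)) \<partial>growth_measure W)"
    unfolding expected_visits_def by (subst suminf_offset[where i = 1]) simp_all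
  then show ?thesis
    unfolding growth_chain_transition expected_visits_def
    using G.emeasure_space_1 by (simp add: add.commute)
qed

text \<open>
  The factor \<open>|c|\<close> turns occupation times into numbers of visits.  A visit is either the initial one,
  at a single vertex, or it follows a visit to some \<open>a\<close>; the numbers of visits to \<open>a\<close> are again
  expressed by \<open>W\<close>, and the factor \<open>|a|\<close> cancels the uniform choice of the vertex of \<open>a\<close>.
\<close>
lemma steady_state_balance:
  fixes f :: "rooted_class \<Rightarrow> ennreal"
  assumes W: "steady_state_law W"
  shows "(\<integral>\<^sup>+c. of_nat (class_size c) * f c \<partial>measure_pmf W) =
    inverse (mean_explosion_time W) * f (abs_rooted_class singleton_graph) +
    (\<integral>\<^sup>+a. \<integral>\<^sup>+b. (\<Sum>w<class_size a.
       f (abs_rooted_class (graft (rep_rooted_class a) w (rep_rooted_class b))))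
       \<partial>measure_pmf W \<partial>measure_pmf W)"
proof -
  define S where "S a = (\<integral>\<^sup>+b. (\<Sum>w<class_size a.
       f (abs_rooted_class (graft (rep_rooted_class a) w (rep_rooted_class b)))) \<partial>measure_pmf W)" for a
  have "of_nat (class_size c) * f c / of_nat (class_size c) = f c" for c
    by (subst mult.commute, subst mult_divide_eq_ennreal) simp_all
  then have "(\<integral>\<^sup>+c. of_nat (class_size c) * f c \<partial>measure_pmf W) = expected_visits W f / mean_explosion_time W"
    by (simp add: steady_state_nn_integral[OF W])
  also have "expected_visits W f = f (abs_rooted_class singleton_graph) +
      expected_visits W (\<lambda>a. S a / of_nat (class_size a))"
    unfolding S_def by (rule expected_visits_recursion)
  also have "\<dots> / mean_explosion_time W =
      inverse (mean_explosion_time W) * f (abs_rooted_class singleton_graph) + (\<integral>\<^sup>+a. S a \<partial>measure_pmf W)"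
    unfolding steady_state_nn_integral[OF W, of S]
    by (simp add: divide_ennreal_def distrib_left mult.commute)
  finally show ?thesis
    unfolding S_def .
qed

theorem corollary4:
  fixes W :: "rooted_class pmf"
  assumes "steady_state_law W"
  shows "reroot_law W = W"
  by (rule reroot_law_eq_if_balance[OF steady_state_balance[OF assms]])

end
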